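(* Let $\mathfrak{A}$ be a combinatorial problem with ground set $\mathbb{B}=\{b_1,\dots,b_n\}$ and family of feasible solutions $\mathcal{F}\subseteq 2^{\mathbb{B}}$, and assume there is a pseudopolynomial time algorithm for $\mathsf{Exact}$-$\mathfrak{A}$. Then for any $\epsilon>0$ there is a polynomial time algorithm for $\mathsf{EUM}$-$\mathfrak{A}$ that finds a feasible solution $S\in\mathcal{F}$ such that $$\mathbb{E}[\mu(X(S))]\ \ge\ \mathsf{OPT}-\epsilon,$$ where $\mathsf{OPT}=\max_{S'\in\mathcal{F}}\mathbb{E}[\mu(X(S'))]$.
   Context: Deterministic problem $\mathfrak{A}$: given nonnegative weights on the elements of $\mathbb{B}$, find a feasible $S\in\mathcal{F}$ of minimum total weight (e.g. shortest path, spanning tree, matching, knapsack). $\mathsf{Exact}$-$\mathfrak{A}$: given integer weights and an integer $K$, find a feasible solution whose total weight is exactly $K$ (or report that none exists). An algorithm for it is pseudopolynomial if its running time is bounded by a polynomial in $n$ and $K$. Expected utility maximization $\mathsf{EUM}$-$\mathfrak{A}$: each element $b$ has a random weight $X_b$, a nonnegative discrete random variable with an explicitly given distribution; the $X_b$ are mutually independent. For $S\subseteq\mathbb{B}$ let $X(S)=\sum_{b\in S}X_b$. A utility function $\mu:\mathbb{R}\to\mathbb{R}^{+}$ is given, with $\lim_{x\to\infty}\mu(x)=0$, and $\mu$ is $\alpha$-Lipschitz on $[0,\infty)$ (that is, $|\mu(x)-\mu(y)|\le\alpha|x-y|$) for a positive constant $\alpha$. The goal is to find $S\in\mathcal{F}$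 maximizing $\mathbb{E}[\mu(X(S))]$. *)

theory Defs
  imports
    "HOL-Probability.Probability"
    "HOL-Computational_Algebra.Polynomial"
    "HOL-Library.Log_Nat"
begin

section \<open>Model of computation\<close>

text \<open>
  Programs operate on binary trees with integers at the leaves. An arithmetic operation costs
  the bit lengths of its operands (logarithmic cost); an operation on the tree structure only
  moves pointers and costs 1. With trees represented as shared pointer structures, a Turing
  machine simulates a program with polynomial overhead: after time \<open>t\<close> on an input of size
  \<open>m\<close> there are at most \<open>m + t\<close> tree cells, and no integer has more than \<open>m + t\<close> bits.
  Conversely a pair of lists serves as a tape. So polynomial time here is the usual notion.
\<close>

datatype data = Atom int | Node data data

definition bit_length :: "int \<Rightarrow> nat" where
  "bit_length a = floorlog 2 (nat \<bar>a\<bar>)"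

fun data_size :: "data \<Rightarrow> nat" where
  "data_size (Atom a) = 1 + bit_length a"
| "data_size (Node u v) = 1 + data_size u + data_size v"

datatype arith = Plus | Minus | Times | Divide | Less

fun arith_fun :: "arith \<Rightarrow> int \<Rightarrow> int \<Rightarrow> int" where
  "arith_fun Plus a b = a + b"
| "arith_fun Minus a b = a - b"
| "arith_fun Times a b = a * b"
| "arith_fun Divide a b = a div b"
| "arith_fun Less a b = (if a < b then 1 else 0)"

datatype prog =
    Skip
  | Lit int
  | Left
  | Right
  | Is_Node
  | Arith arith
  | Fork prog prog
  | Seq prog prog
  | Cond prog prog prog
  | While prog prog

text \<open>
  \<open>run p u v t\<close>: started on \<open>u\<close>, the program \<open>p\<close> halts with result \<open>v\<close> after time \<open>t\<close>.
  A program that applies an operation to an argument of the wrong shape has no result.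
\<close>

inductive run :: "prog \<Rightarrow> data \<Rightarrow> data \<Rightarrow> nat \<Rightarrow> bool" where
  run_Skip: "run Skip u u 1"
| run_Lit: "run (Lit a) u (Atom a) (1 + bit_length a)"
| run_Left: "run Left (Node u v) u 1"
| run_Right: "run Right (Node u v) v 1"
| run_Is_Node_Atom: "run Is_Node (Atom a) (Atom 0) 1"
| run_Is_Node_Node: "run Is_Node (Node u v) (Atom 1) 1"
| run_Arith: "run (Arith f) (Node (Atom a) (Atom b)) (Atom (arith_fun f a b))
    (1 + bit_length a + bit_length b)"
| run_Fork: "run p u v s \<Longrightarrow> run q u w t \<Longrightarrow> run (Fork p q) u (Node v w) (1 + s + t)"
| run_Seq: "run p u v s \<Longrightarrow> run q v w t \<Longrightarrow> run (Seq p q) u w (1 + s + t)"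
| run_Cond_True: "run c u (Atom a) r \<Longrightarrow> a \<noteq> 0 \<Longrightarrow> run p u v t
    \<Longrightarrow> run (Cond c p q) u v (1 + r + t)"
| run_Cond_False: "run c u (Atom 0) r \<Longrightarrow> run q u v t \<Longrightarrow> run (Cond c p q) u v (1 + r + t)"
| run_While_True: "run c u (Atom a) r \<Longrightarrow> a \<noteq> 0 \<Longrightarrow> run p u v s \<Longrightarrow> run (While c p) v w t
    \<Longrightarrow> run (While c p) u w (1 + r + s + t)"
| run_While_False: "run c u (Atom 0) r \<Longrightarrow> run (While c p) u u (1 + r)"

inductive_cases run_SkipE: "run Skip u v t"
inductive_cases run_LitE: "run (Lit a) u v t"
inductive_cases run_LeftE: "run Left u v t"
inductive_cases run_RightE: "run Right u v t"
inductive_cases run_Is_NodeE: "run Is_Node u v t"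
inductive_cases run_ArithE: "run (Arith f) u v t"
inductive_cases run_ForkE: "run (Fork p q) u v t"
inductive_cases run_SeqE: "run (Seq p q) u v t"
inductive_cases run_CondE: "run (Cond c p q) u v t"
inductive_cases run_WhileE: "run (While c p) u v t"

lemma run_deterministic:
  assumes "run p u v t" and "run p u v' t'"
  shows "v' = v \<and> t' = t"
  using assms
proof (induction arbitrary: v' t' rule: run.induct)
  case (run_Fork p u v s q w t)
  show ?case using run_Fork.prems by (rule run_ForkE) (auto dest: run_Fork.IH)
next
  case (run_Seq p u v s q w t)
  show ?case using run_Seq.prems by (rule run_SeqE) (auto dest!: run_Seq.IH)
next
  case (run_Cond_True c u a r p v t q)
  show ?case using run_Cond_True.prems
    by (rule run_CondE) (use run_Cond_True.hyps in \<open>auto dest!: run_Cond_True.IH\<close>)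
next
  case (run_Cond_False c u r q v t p)
  show ?case using run_Cond_False.prems
    by (rule run_CondE) (auto dest!: run_Cond_False.IH)
next
  case (run_While_True c u a r p v s w t)
  show ?case using run_While_True.prems
    by (rule run_WhileE) (use run_While_True.hyps in \<open>auto dest!: run_While_True.IH\<close>)
next
  case (run_While_False c u r p)
  show ?case using run_While_False.prems
    by (rule run_WhileE) (auto dest!: run_While_False.IH)
qed (auto elim: run_SkipE run_LitE run_LeftE run_RightE run_Is_NodeE run_ArithE)

definition outputs_within :: "prog \<Rightarrow> data \<Rightarrow> nat \<Rightarrow> data set \<Rightarrow> bool" where
  "outputs_within p u T V \<longleftrightarrow> (\<exists>v t. run p u v t \<and> t \<le> T \<and> v \<in> V)"

section \<open>Encodings\<close>

fun enc_list :: "data list \<Rightarrow> data" where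
  "enc_list [] = Atom 0"
| "enc_list (u # us) = Node u (enc_list us)"

definition enc_rat :: "rat \<Rightarrow> data" where
  "enc_rat q = Node (Atom (fst (quotient_of q))) (Atom (snd (quotient_of q)))"

text \<open>A subset of the ground set, as its characteristic vector.\<close>

definition enc_subset :: "nat \<Rightarrow> nat set \<Rightarrow> data" where
  "enc_subset n S = enc_list (map (\<lambda>b. Atom (if b \<in> S then 1 else 0)) [0..<n])"

section \<open>Combinatorial problems\<close>

text \<open>
  A problem comprises all its instances, each described by a tree (a graph, a list of item sizes
  and a capacity, ...). The \<open>n\<close> elements of the ground set of an instance are numbered
  \<open>0, \<dots>, n - 1\<close>.
\<close>

record problem =
  instances :: "data set"
  ground_size :: "data \<Rightarrow> nat"
  feasible :: "data \<Rightarrow> nat set set"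

definition combinatorial_problem :: "problem \<Rightarrow> bool" where
  "combinatorial_problem A \<longleftrightarrow>
     (\<forall>x \<in> instances A. feasible A x \<subseteq> Pow {..<ground_size A x})"

section \<open>The exact version\<close>

definition exact_input :: "data \<Rightarrow> int list \<Rightarrow> int \<Rightarrow> data" where
  "exact_input x w K = Node x (Node (enc_list (map Atom w)) (Atom K))"

definition exact_solutions :: "problem \<Rightarrow> data \<Rightarrow> int list \<Rightarrow> int \<Rightarrow> nat set set" where
  "exact_solutions A x w K = {S \<in> feasible A x. (\<Sum>b\<in>S. w ! b) = K}"

definition exact_answers :: "problem \<Rightarrow> data \<Rightarrow> int list \<Rightarrow> int \<Rightarrow> data set" where
  "exact_answers A x w K =
     (if exact_solutions A x w K = {} then {Atom 0}
      else (\<lambda>S. Node (Atom 1) (enc_subset (ground_size A x) S)) ` exact_solutions A x w K)"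

text \<open>
  Weights and target are nonnegative, as in the deterministic problem; with negative integers
  of unbounded size, a bound in terms of the target alone would be far too restrictive. The
  length of the input is at least \<open>n\<close>, so that this notion covers every algorithm whose running
  time is bounded by a polynomial in \<open>n\<close> and \<open>K\<close>; a polynomial in two quantities is dominated by a
  polynomial in their sum.
\<close>

definition pseudopolynomial_exact :: "problem \<Rightarrow> prog \<Rightarrow> bool" where
  "pseudopolynomial_exact A p \<longleftrightarrow>
     (\<exists>P :: nat poly. \<forall>x \<in> instances A. \<forall>w K.
        length w = ground_size A x \<and> (\<forall>c \<in> set w. 0 \<le> c) \<and> 0 \<le> K \<longrightarrow>
        outputs_within p (exact_input x w K)
          (poly P (data_size (exact_input x w K) + nat K)) (exact_answers A x w K))"

section \<open>Expected utility maximization\<close>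

text \<open>A discrete distribution given explicitly by pairs of a value and its probability.\<close>

type_synonym distribution = "(rat \<times> rat) list"

definition real_distribution :: "distribution \<Rightarrow> (real \<times> real) list" where
  "real_distribution d = map (map_prod of_rat of_rat) d"

definition valid_distribution :: "distribution \<Rightarrow> bool" where
  "valid_distribution d \<longleftrightarrow>
     pmf_of_list_wf (real_distribution d) \<and> (\<forall>(v, q) \<in> set d. 0 \<le> v)"

definition weights_pmf :: "distribution list \<Rightarrow> (nat \<Rightarrow> real) pmf" where
  "weights_pmf ds = Pi_pmf {..<length ds} 0 (\<lambda>b. pmf_of_list (real_distribution (ds ! b)))"

definition expected_utility :: "(real \<Rightarrow> real) \<Rightarrow> distribution list \<Rightarrow> nat set \<Rightarrow> real" where
  "expected_utility \<mu> ds S =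
     measure_pmf.expectation (weights_pmf ds) (\<lambda>X. \<mu> (\<Sum>b\<in>S. X b))"

definition optimal_utility :: "problem \<Rightarrow> (real \<Rightarrow> real) \<Rightarrow> data \<Rightarrow> distribution list \<Rightarrow> real" where
  "optimal_utility A \<mu> x ds = Max (expected_utility \<mu> ds ` feasible A x)"

definition eum_input :: "data \<Rightarrow> distribution list \<Rightarrow> data" where
  "eum_input x ds =
     Node x (enc_list (map (\<lambda>d. enc_list (map (\<lambda>(v, q). Node (enc_rat v) (enc_rat q)) d)) ds))"

text \<open>Nothing is required of the answer if there is no feasible solution.\<close>

definition eum_answers ::
  "problem \<Rightarrow> (real \<Rightarrow> real) \<Rightarrow> real \<Rightarrow> data \<Rightarrow> distribution list \<Rightarrow> data set" where
  "eum_answers A \<mu> \<epsilon> x ds =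
     (if feasible A x = {} then UNIV
      else enc_subset (ground_size A x) `
        {S \<in> feasible A x. expected_utility \<mu> ds S \<ge> optimal_utility A \<mu> x ds - \<epsilon>})"

text \<open>
  The utility function and the error bound are fixed; they are not part of the input.
\<close>

definition polynomial_time_eum :: "problem \<Rightarrow> (real \<Rightarrow> real) \<Rightarrow> real \<Rightarrow> prog \<Rightarrow> bool" where
  "polynomial_time_eum A \<mu> \<epsilon> p \<longleftrightarrow>
     (\<exists>P :: nat poly. \<forall>x \<in> instances A. \<forall>ds.
        length ds = ground_size A x \<and> (\<forall>d \<in> set ds. valid_distribution d) \<longrightarrow>
        outputs_within p (eum_input x ds)
          (poly P (data_size (eum_input x ds))) (eum_answers A \<mu> \<epsilon> x ds))"

end

theory Submission
  imports Defs
begin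

text \<open>
  In the variable \<open>exp (- x)\<close> the utility function extends to a continuous function on \<open>[0, 1]\<close>,
  because it tends to 0 at infinity. By the Weierstrass theorem it is uniformly close to an
  exponential sum \<open>\<Sum>\<^sub>k (c\<^sub>k / D) exp (- k x)\<close> with integers \<open>c\<^sub>k\<close> and \<open>D\<close>. By independence, the
  expectation of \<open>exp (- k X(S))\<close> is the product over \<open>b \<in> S\<close> of the Laplace transforms of \<open>X\<^sub>b\<close>
  at \<open>k\<close>. With \<open>N\<close> proportional to \<open>n\<close>, replacing \<open>exp (- x)\<close> by \<open>(1 - 1 / N) ^ \<lfloor>N x\<rfloor>\<close>, with \<open>\<lfloor>N x\<rfloor>\<close>
  truncated at \<open>O(N)\<close>, turns these transforms into rational numbers of polynomial length. Their
  logarithms to the base \<open>1 - 1 / N\<close> are rounded to integers and truncated at \<open>O(N)\<close> as well. For each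
  of the constantly many values of \<open>k\<close> this changes the product by at most a small constant, since
  \<open>S\<close> has at most \<open>n\<close> elements.

  The rounded logarithms for all \<open>k\<close> are the digits of a single weight in a base of polynomial size. For
  each of the polynomially many targets \<open>K\<close> the digits of \<open>K\<close> determine the approximate utility
  of every solution of total weight exactly \<open>K\<close>, so that it suffices to solve the exact problem
  for all targets and to keep the best solvable one.
\<close>

section \<open>Polynomially bounded quantities\<close>

text \<open>The coefficients \<open>c\<^sub>k\<close> may be negative, so the approximate utility
  need not be monotone in any of the weights and optimizing a weight would not help; control over
  exact totals is what is required. The exact algorithm is polynomial in the value of the target, so
  the rounded logarithms must be polynomially bounded and their number must not depend on the input.
  The latter holds because \<open>\<mu>\<close> and \<open>\<epsilon>\<close> are fixed: degree,
  coefficients and an accuracy parameter \<open>H\<close> are literals of the program. With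
  \<open>N = H (n + 2)\<close>, rounding \<open>n\<close> numbers to the grid costs at most
  \<open>n / N \<le> 1 / H\<close>. Both truncations are at \<open>H N\<close>, where
  \<open>(1 - 1 / N) ^ (H N) \<le> exp (- H) \<le> 1 / H\<close>, so that a truncated exponent
  already stands for a negligible value. The polynomial approximation takes
  \<open>\<epsilon> / 4\<close> of the error, discretization and rounding together another
  \<open>\<epsilon> / 4\<close>. Both the selected and the optimal solution are thus misjudged by at
  most \<open>\<epsilon> / 2\<close>.\<close>

definition poly_bounded :: "'i set \<Rightarrow> ('i \<Rightarrow> nat) \<Rightarrow> ('i \<Rightarrow> nat) \<Rightarrow> bool" where
  "poly_bounded I sz f \<longleftrightarrow> (\<exists>P :: nat poly. \<forall>i\<in>I. f i \<le> poly P (sz i))"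

lemma poly_nat_mono:
  fixes P :: "nat poly"
  assumes "a \<le> b"
  shows "poly P a \<le> poly P b"
  by (induction P) (use assms in \<open>auto intro: add_mono mult_mono\<close>)

lemma poly_bounded_mono:
  assumes "poly_bounded I sz g" and "\<And>i. i \<in> I \<Longrightarrow> f i \<le> g i"
  shows "poly_bounded I sz f"
  using assms unfolding poly_bounded_def by (meson order_trans)

lemma poly_bounded_const [intro, simp]: "poly_bounded I sz (\<lambda>_. c)"
  unfolding poly_bounded_def by (rule exI[of _ "[:c:]"]) simp

lemma poly_bounded_size: "poly_bounded I sz sz"
  unfolding poly_bounded_def by (rule exI[of _ "[:0, 1:]"]) simp

lemma poly_bounded_add:
  assumes "poly_bounded I sz f" and "poly_bounded I sz g"
  shows "poly_bounded I sz (\<lambda>i. f i + g i)"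
proof -
  obtain P Q where "\<forall>i\<in>I. f i \<le> poly P (sz i)" "\<forall>i\<in>I. g i \<le> poly Q (sz i)"
    using assms unfolding poly_bounded_def by blast
  then have "\<forall>i\<in>I. f i + g i \<le> poly (P + Q) (sz i)"
    by (auto intro: add_mono)
  then show ?thesis unfolding poly_bounded_def by blast
qed

lemma poly_bounded_mult:
  assumes "poly_bounded I sz f" and "poly_bounded I sz g"
  shows "poly_bounded I sz (\<lambda>i. f i * g i)"
proof -
  obtain P Q where "\<forall>i\<in>I. f i \<le> poly P (sz i)" "\<forall>i\<in>I. g i \<le> poly Q (sz i)"
    using assms unfolding poly_bounded_def by blast
  then have "\<forall>i\<in>I. f i * g i \<le> poly (P * Q) (sz i)"
    by (auto intro: mult_mono)
  then show ?thesis unfolding poly_bounded_def by blast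
qed

lemma poly_bounded_Suc:
  assumes "poly_bounded I sz f"
  shows "poly_bounded I sz (\<lambda>i. Suc (f i))"
  using poly_bounded_add[OF assms poly_bounded_const[of I sz 1]] by simp

lemma poly_bounded_poly:
  assumes "poly_bounded I sz f"
  shows "poly_bounded I sz (\<lambda>i. poly P (f i))"
proof -
  obtain Q where "\<forall>i\<in>I. f i \<le> poly Q (sz i)"
    using assms unfolding poly_bounded_def by blast
  then have "\<forall>i\<in>I. poly P (f i) \<le> poly (pcompose P Q) (sz i)"
    by (auto simp: poly_pcompose intro: poly_nat_mono)
  then show ?thesis unfolding poly_bounded_def by blast
qed

text \<open>One polynomial serves the whole family, so a bound survives pulling back along any map;
  loops use this to add an iteration number to the index.\<close>

lemma poly_bounded_reindex:
  assumes "poly_bounded I sz f" and "\<And>x. x \<in> I' \<Longrightarrow> h x \<in> I"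
  shows "poly_bounded I' (\<lambda>x. sz (h x)) (\<lambda>x. f (h x))"
  using assms unfolding poly_bounded_def by blast

lemma poly_bounded_fst:
  assumes "poly_bounded I sz f"
  shows "poly_bounded (Sigma I B) (\<lambda>x. sz (fst x)) (\<lambda>x. f (fst x))"
  using assms by (rule poly_bounded_reindex) auto

text \<open>Gives the total time of a loop: the polynomial is uniform over the iterations, and their
  number is itself polynomially bounded.\<close>

lemma poly_bounded_sum:
  assumes "poly_bounded (SIGMA i:I. {..<n i}) (\<lambda>x. sz (fst x)) f" and "poly_bounded I sz n"
  shows "poly_bounded I sz (\<lambda>i. \<Sum>j<n i. f (i, j))"
proof -
  obtain P where P: "\<And>i j. i \<in> I \<Longrightarrow> j < n i \<Longrightarrow> f (i, j) \<le> poly P (sz i)"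
    using assms(1) unfolding poly_bounded_def by auto
  have "poly_bounded I sz (\<lambda>i. n i * poly P (sz i))"
    by (intro poly_bounded_mult assms poly_bounded_poly poly_bounded_size)
  then show ?thesis
  proof (rule poly_bounded_mono)
    fix i assume "i \<in> I"
    then have "(\<Sum>j<n i. f (i, j)) \<le> (\<Sum>j<n i. poly P (sz i))"
      by (intro sum_mono P) auto
    then show "(\<Sum>j<n i. f (i, j)) \<le> n i * poly P (sz i)" by simp
  qed
qed

section \<open>Bit lengths\<close>

lemma bit_length_le_iff: "bit_length a \<le> k \<longleftrightarrow> \<bar>a\<bar> < 2 ^ k"
  unfolding bit_length_def by (auto simp: floorlog_le_iff nat_less_iff)

lemma abs_less_bit_length: "\<bar>a\<bar> < 2 ^ bit_length a"
  using bit_length_le_iff by blast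

lemma bit_length_0 [simp]: "bit_length 0 = 0"
  using bit_length_le_iff[of 0 0] by simp

lemma bit_length_mono: "\<bar>a\<bar> \<le> \<bar>b\<bar> \<Longrightarrow> bit_length a \<le> bit_length b"
  using abs_less_bit_length[of b] by (simp add: bit_length_le_iff)

lemma bit_length_le_add:
  assumes "\<bar>c\<bar> \<le> \<bar>a\<bar> + \<bar>b\<bar>"
  shows "bit_length c \<le> Suc (max (bit_length a) (bit_length b))"
proof -
  let ?k = "max (bit_length a) (bit_length b)"
  have "\<bar>a\<bar> < 2 ^ ?k" "\<bar>b\<bar> < 2 ^ ?k"
    by (simp_all add: bit_length_le_iff[symmetric])
  then show ?thesis using assms by (simp add: bit_length_le_iff)
qed

lemma bit_length_mult: "bit_length (a * b) \<le> bit_length a + bit_length b"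
  unfolding bit_length_le_iff abs_mult power_add
  by (intro mult_strict_mono abs_less_bit_length) auto

lemma bit_length_power: "bit_length (a ^ k) \<le> Suc (k * bit_length a)"
proof (induction k)
  case (Suc k)
  have "bit_length (a ^ Suc k) \<le> bit_length a + bit_length (a ^ k)"
    using bit_length_mult by simp
  with Suc show ?case by simp
qed (simp add: bit_length_le_iff)

text \<open>The crude bound \<open>n < 2 ^ n\<close> suffices, because quantities treated as natural
  numbers are polynomially bounded in value.\<close>

lemma bit_length_int_le: "bit_length (int n) \<le> n"
  unfolding bit_length_le_iff by (simp add: of_nat_less_two_power)

lemma bit_length_arith_fun:
  "bit_length (arith_fun f a b) \<le> Suc (bit_length a + bit_length b)"
proof (cases f)
  case Divide
  \<comment> \<open>\<open>div\<close> rounds towards minus infinity, so the quotient is enclosed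
    between those of \<open>- \<bar>a\<bar>\<close> and \<open>\<bar>a\<bar>\<close>, and then
    \<open>c\<close> is replaced by \<open>1\<close>.\<close>
  have *: "\<bar>a div c\<bar> \<le> \<bar>a\<bar>" if "0 < c" for a c :: int
  proof -
    have "a div c \<le> \<bar>a\<bar> div c" "- \<bar>a\<bar> div c \<le> a div c"
      using that by (auto intro: zdiv_mono1)
    moreover have "\<bar>a\<bar> div c \<le> \<bar>a\<bar> div 1" "- \<bar>a\<bar> div 1 \<le> - \<bar>a\<bar> div c"
      using that zdiv_mono2[of "\<bar>a\<bar>" 1 c] zdiv_mono2_neg[of "- \<bar>a\<bar>" 1 c]
      by (cases "a = 0"; simp)+
    ultimately show ?thesis by simp
  qed
  \<comment> \<open>A negative divisor is handled by changing both signs; division by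
    \<open>0\<close> yields \<open>0\<close>.\<close>
  have "\<bar>a div b\<bar> \<le> \<bar>a\<bar>"
    using *[of b a] *[of "- b" "- a"] by (cases "b = 0"; cases "0 < b") auto
  then have "bit_length (a div b) \<le> bit_length a" by (rule bit_length_mono)
  then show ?thesis using Divide by simp
next
  case Times
  then show ?thesis using bit_length_mult[of a b] by simp
next
  case Plus
  then show ?thesis using bit_length_le_add[of "a + b" a b] abs_triangle_ineq[of a b]
    by (auto simp: max_def split: if_splits)
next
  case Minus
  then show ?thesis using bit_length_le_add[of "a - b" a b] abs_triangle_ineq4[of a b]
    by (auto simp: max_def split: if_splits)
next
  case Less
  have "bit_length (arith_fun Less a b) \<le> 1" by (simp add: bit_length_le_iff)
  then show ?thesis using Less by simp
qed

section \<open>Evaluation of expressions in polynomial time\<close>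

text \<open>
  Programs are used as expressions over an environment, a tree in which the innermost variable
  is the right child of the root. Statements about running times are made for families of inputs:
  an index \<open>i \<in> I\<close> stands for all the mathematical objects encoded in the environment \<open>E i\<close>,
  and \<open>sz i\<close> is the size in terms of which running times are measured. A loop enlarges the index
  by the number of the iteration.
\<close>

definition evaluates ::
  "'i set \<Rightarrow> ('i \<Rightarrow> nat) \<Rightarrow> prog \<Rightarrow> ('i \<Rightarrow> data) \<Rightarrow> ('i \<Rightarrow> data) \<Rightarrow> bool" where
  "evaluates I sz p E v \<longleftrightarrow> (\<exists>t. poly_bounded I sz t \<and> (\<forall>i\<in>I. run p (E i) (v i) (t i)))"

lemma evaluates_cong:
  assumes "evaluates I sz p E v"
    and "\<And>i. i \<in> I \<Longrightarrow> E i = E' i" and "\<And>i. i \<in> I \<Longrightarrow> v i = v' i"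
  shows "evaluates I sz p E' v'"
  using assms unfolding evaluates_def by metis

lemma evaluates_reindex:
  assumes "evaluates I sz p E v" and "\<And>x. x \<in> I' \<Longrightarrow> h x \<in> I"
  shows "evaluates I' (\<lambda>x. sz (h x)) p (\<lambda>x. E (h x)) (\<lambda>x. v (h x))"
  using assms poly_bounded_reindex[of I sz _ I' h] unfolding evaluates_def by metis

lemma evaluates_subset:
  assumes "evaluates I sz p E v" and "I' \<subseteq> I"
  shows "evaluates I' sz p E v"
  using evaluates_reindex[of I sz p E v I' "\<lambda>x. x"] assms by auto

lemma evaluates_Skip: "evaluates I sz Skip E E"
  unfolding evaluates_def by (rule exI[of _ "\<lambda>_. 1"]) (auto intro: run_Skip[simplified])

lemma evaluates_Lit: "evaluates I sz (Lit a) E (\<lambda>_. Atom a)"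
  unfolding evaluates_def by (rule exI[of _ "\<lambda>_. 1 + bit_length a"]) (auto intro: run_Lit[simplified])

lemma evaluates_Left: "evaluates I sz Left (\<lambda>i. Node (u i) (v i)) u"
  unfolding evaluates_def by (rule exI[of _ "\<lambda>_. 1"]) (auto intro: run_Left[simplified])

lemma evaluates_Right: "evaluates I sz Right (\<lambda>i. Node (u i) (v i)) v"
  unfolding evaluates_def by (rule exI[of _ "\<lambda>_. 1"]) (auto intro: run_Right[simplified])

lemma evaluates_Is_Node:
  "evaluates I sz Is_Node v (\<lambda>i. Atom (case v i of Atom _ \<Rightarrow> 0 | Node _ _ \<Rightarrow> 1))"
  unfolding evaluates_def
  by (rule exI[of _ "\<lambda>_. 1"])
    (auto split: data.split intro: run_Is_Node_Atom[simplified] run_Is_Node_Node[simplified])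

lemma evaluates_Fork:
  assumes "evaluates I sz p E v" and "evaluates I sz q E w"
  shows "evaluates I sz (Fork p q) E (\<lambda>i. Node (v i) (w i))"
proof -
  obtain s t where *: "poly_bounded I sz s" "\<forall>i\<in>I. run p (E i) (v i) (s i)"
    "poly_bounded I sz t" "\<forall>i\<in>I. run q (E i) (w i) (t i)"
    using assms unfolding evaluates_def by blast
  have "poly_bounded I sz (\<lambda>i. 1 + s i + t i)"
    by (intro poly_bounded_add poly_bounded_const *)
  moreover have "\<forall>i\<in>I. run (Fork p q) (E i) (Node (v i) (w i)) (1 + s i + t i)"
    using * run_Fork by blast
  ultimately show ?thesis unfolding evaluates_def by blast
qed

lemma evaluates_Seq:
  assumes "evaluates I sz p E v" and "evaluates I sz q v w"
  shows "evaluates I sz (Seq p q) E w"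
proof -
  obtain s t where *: "poly_bounded I sz s" "\<forall>i\<in>I. run p (E i) (v i) (s i)"
    "poly_bounded I sz t" "\<forall>i\<in>I. run q (v i) (w i) (t i)"
    using assms unfolding evaluates_def by blast
  have "poly_bounded I sz (\<lambda>i. 1 + s i + t i)"
    by (intro poly_bounded_add poly_bounded_const *)
  moreover have "\<forall>i\<in>I. run (Seq p q) (E i) (w i) (1 + s i + t i)"
    using * run_Seq by blast
  ultimately show ?thesis unfolding evaluates_def by blast
qed

text \<open>Each branch has to run only where the condition selects it. This matters for
  \<open>Left\<close> and \<open>Right\<close>, which have no result on an atom.\<close>

lemma evaluates_Cond:
  assumes "evaluates I sz c E (\<lambda>i. Atom (if P i then 1 else 0))"
    and "evaluates {i\<in>I. P i} sz p E v" and "evaluates {i\<in>I. \<not> P i} sz q E w"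
  shows "evaluates I sz (Cond c p q) E (\<lambda>i. if P i then v i else w i)"
proof -
  obtain r s t where *: "poly_bounded I sz r" "\<forall>i\<in>I. run c (E i) (Atom (if P i then 1 else 0)) (r i)"
    "poly_bounded {i\<in>I. P i} sz s" "\<forall>i\<in>{i\<in>I. P i}. run p (E i) (v i) (s i)"
    "poly_bounded {i\<in>I. \<not> P i} sz t" "\<forall>i\<in>{i\<in>I. \<not> P i}. run q (E i) (w i) (t i)"
    using assms unfolding evaluates_def by blast
  \<comment> \<open>The time of a branch is bounded only on its own subfamily; elsewhere it is set
    to \<open>0\<close>.\<close>
  have "poly_bounded I sz (\<lambda>i. if P i then s i else 0)"
    using *(3) unfolding poly_bounded_def by auto
  moreover have "poly_bounded I sz (\<lambda>i. if P i then 0 else t i)"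
    using *(5) unfolding poly_bounded_def by auto
  ultimately have "poly_bounded I sz
      (\<lambda>i. 1 + r i + ((if P i then s i else 0) + (if P i then 0 else t i)))"
    by (intro poly_bounded_add poly_bounded_const *)
  moreover have "run (Cond c p q) (E i) (if P i then v i else w i)
      (1 + r i + ((if P i then s i else 0) + (if P i then 0 else t i)))" if "i \<in> I" for i
  proof (cases "P i")
    case True
    then show ?thesis using * that run_Cond_True[of c "E i" 1 "r i" p "v i" "s i" q] by auto
  next
    case False
    then show ?thesis using * that run_Cond_False[of c "E i" "r i" q "w i" "t i" p] by auto
  qed
  ultimately show ?thesis unfolding evaluates_def by blast
qed

text \<open>\<open>S i j\<close> is the state after \<open>j\<close> iterations. The test runs once
  more than the body, hence \<open>{..n i}\<close> for \<open>c\<close> but \<open>{..<n i}\<close>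
  for \<open>p\<close>.\<close>

lemma evaluates_While:
  assumes c: "evaluates (SIGMA i:I. {..n i}) (\<lambda>x. sz (fst x)) c (\<lambda>x. S (fst x) (snd x))
      (\<lambda>x. Atom (if snd x < n (fst x) then 1 else 0))"
    and p: "evaluates (SIGMA i:I. {..<n i}) (\<lambda>x. sz (fst x)) p (\<lambda>x. S (fst x) (snd x))
      (\<lambda>x. S (fst x) (Suc (snd x)))"
    and n: "poly_bounded I sz n"
  shows "evaluates I sz (While c p) (\<lambda>i. S i 0) (\<lambda>i. S i (n i))"
proof -
  obtain r where r: "poly_bounded (SIGMA i:I. {..n i}) (\<lambda>x. sz (fst x)) r"
    "\<And>i j. i \<in> I \<Longrightarrow> j \<le> n i \<Longrightarrow> run c (S i j) (Atom (if j < n i then 1 else 0)) (r (i, j))"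
    using c unfolding evaluates_def by fastforce
  obtain s where s: "poly_bounded (SIGMA i:I. {..<n i}) (\<lambda>x. sz (fst x)) s"
    "\<And>i j. i \<in> I \<Longrightarrow> j < n i \<Longrightarrow> run p (S i j) (S i (Suc j)) (s (i, j))"
    using p unfolding evaluates_def by fastforce
  \<comment> \<open>Time still needed after \<open>k\<close> iterations, including the final failing
    test. The induction runs backwards from \<open>n i\<close>, since \<open>run_While_True\<close>
    adds an iteration in front.\<close>
  define t where "t i k = (\<Sum>j=k..<n i. 1 + r (i, j) + s (i, j)) + (1 + r (i, n i))" for i k
  have "run (While c p) (S i k) (S i (n i)) (t i k)" if "i \<in> I" "k \<le> n i" for i k
    using \<open>k \<le> n i\<close>
  proof (induction k rule: inc_induct)
    case base
    show ?case using r(2)[OF \<open>i \<in> I\<close>, of "n i"] by (auto simp: t_def intro: run_While_False[simplified])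
  next
    case (step k)
    have "run (While c p) (S i k) (S i (n i)) (1 + r (i, k) + s (i, k) + t i (Suc k))"
      using r(2)[OF \<open>i \<in> I\<close>, of k] s(2)[OF \<open>i \<in> I\<close>, of k] step
      by (intro run_While_True[of _ _ 1]) auto
    moreover have "t i k = 1 + r (i, k) + s (i, k) + t i (Suc k)"
      using step by (simp add: t_def sum.atLeast_Suc_lessThan)
    ultimately show ?case by simp
  qed
  moreover have "poly_bounded I sz (\<lambda>i. t i 0)"
  proof -
    have "poly_bounded (SIGMA i:I. {..<n i}) (\<lambda>x. sz (fst x)) r"
      using poly_bounded_reindex[OF r(1), of "SIGMA i:I. {..<n i}" "\<lambda>x. x"] by auto
    then have "poly_bounded (SIGMA i:I. {..<n i}) (\<lambda>x. sz (fst x)) (\<lambda>x. 1 + r x + s x)"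
      by (intro poly_bounded_add poly_bounded_const s)
    then have "poly_bounded I sz (\<lambda>i. \<Sum>j<n i. 1 + r (i, j) + s (i, j))"
      using n by (rule poly_bounded_sum)
    moreover have "poly_bounded I sz (\<lambda>i. r (i, n i))"
      using poly_bounded_reindex[OF r(1), of I "\<lambda>i. (i, n i)"] by auto
    ultimately show ?thesis
      unfolding t_def lessThan_atLeast0[symmetric]
      by (intro poly_bounded_add poly_bounded_const) auto
  qed
  ultimately show ?thesis unfolding evaluates_def by (intro exI[of _ "\<lambda>i. t i 0"]) auto
qed

section \<open>Arithmetic expressions with bounds on their values\<close>

definition evaluates_int ::
  "'i set \<Rightarrow> ('i \<Rightarrow> nat) \<Rightarrow> prog \<Rightarrow> ('i \<Rightarrow> data) \<Rightarrow> ('i \<Rightarrow> int) \<Rightarrow> bool" where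
  "evaluates_int I sz p E a \<longleftrightarrow>
     evaluates I sz p E (\<lambda>i. Atom (a i)) \<and> poly_bounded I sz (\<lambda>i. bit_length (a i))"

text \<open>For integers the number of bits has to be bounded, for natural numbers the value itself.\<close>

definition evaluates_nat ::
  "'i set \<Rightarrow> ('i \<Rightarrow> nat) \<Rightarrow> prog \<Rightarrow> ('i \<Rightarrow> data) \<Rightarrow> ('i \<Rightarrow> nat) \<Rightarrow> bool" where
  "evaluates_nat I sz p E n \<longleftrightarrow>
     evaluates I sz p E (\<lambda>i. Atom (int (n i))) \<and> poly_bounded I sz n"

lemma evaluates_int_imp: "evaluates_int I sz p E a \<Longrightarrow> evaluates I sz p E (\<lambda>i. Atom (a i))"
  unfolding evaluates_int_def by blast

lemma evaluates_nat_imp: "evaluates_nat I sz p E n \<Longrightarrow> evaluates I sz p E (\<lambda>i. Atom (int (n i)))"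
  unfolding evaluates_nat_def by blast

lemma evaluates_int_of_nat:
  assumes "evaluates_nat I sz p E n"
  shows "evaluates_int I sz p E (\<lambda>i. int (n i))"
  using assms unfolding evaluates_nat_def evaluates_int_def
  by (auto intro: poly_bounded_mono bit_length_int_le)

lemma evaluates_nat_of_int:
  assumes "evaluates_int I sz p E a" and "poly_bounded I sz n"
    and "\<And>i. i \<in> I \<Longrightarrow> a i = int (n i)"
  shows "evaluates_nat I sz p E n"
  using assms evaluates_cong[of I sz p E "\<lambda>i. Atom (a i)" E "\<lambda>i. Atom (int (n i))"]
  unfolding evaluates_nat_def evaluates_int_def by simp

lemma evaluates_int_cong:
  assumes "evaluates_int I sz p E a" and "\<And>i. i \<in> I \<Longrightarrow> a i = b i"
  shows "evaluates_int I sz p E b"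
  using assms evaluates_cong[of I sz p E "\<lambda>i. Atom (a i)" E "\<lambda>i. Atom (b i)"]
    poly_bounded_mono[of I sz "\<lambda>i. bit_length (a i)" "\<lambda>i. bit_length (b i)"]
  unfolding evaluates_int_def by simp

lemma evaluates_int_Lit: "evaluates_int I sz (Lit c) E (\<lambda>_. c)"
  unfolding evaluates_int_def by (simp add: evaluates_Lit)

lemma evaluates_nat_Lit: "evaluates_nat I sz (Lit (int c)) E (\<lambda>_. c)"
  unfolding evaluates_nat_def by (simp add: evaluates_Lit)

lemma evaluates_int_Right:
  assumes "poly_bounded I sz (\<lambda>i. bit_length (a i))"
  shows "evaluates_int I sz Right (\<lambda>i. Node (u i) (Atom (a i))) a"
  using assms unfolding evaluates_int_def by (simp add: evaluates_Right)

lemma evaluates_nat_Right: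
  assumes "poly_bounded I sz n"
  shows "evaluates_nat I sz Right (\<lambda>i. Node (u i) (Atom (int (n i)))) n"
  using assms unfolding evaluates_nat_def by (simp add: evaluates_Right)

definition op :: "arith \<Rightarrow> prog \<Rightarrow> prog \<Rightarrow> prog" where
  "op f p q = Seq (Fork p q) (Arith f)"

text \<open>An arithmetic operation is charged the lengths of its operands, so the bit bounds
  carried by \<open>evaluates_int\<close> make its cost polynomial; the same sum, up to a constant,
  bounds the length of the result.\<close>

lemma evaluates_int_op:
  assumes "evaluates_int I sz p E a" and "evaluates_int I sz q E b"
  shows "evaluates_int I sz (op f p q) E (\<lambda>i. arith_fun f (a i) (b i))"
proof -
  have b: "poly_bounded I sz (\<lambda>i. 1 + bit_length (a i) + bit_length (b i))"
    using assms unfolding evaluates_int_def by (intro poly_bounded_add poly_bounded_const) auto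
  then have "evaluates I sz (Arith f) (\<lambda>i. Node (Atom (a i)) (Atom (b i)))
      (\<lambda>i. Atom (arith_fun f (a i) (b i)))"
    unfolding evaluates_def using run_Arith by blast
  then have "evaluates I sz (op f p q) E (\<lambda>i. Atom (arith_fun f (a i) (b i)))"
    unfolding op_def
    by (rule evaluates_Seq[OF evaluates_Fork[OF evaluates_int_imp[OF assms(1)] evaluates_int_imp[OF assms(2)]]])
  moreover have "poly_bounded I sz (\<lambda>i. bit_length (arith_fun f (a i) (b i)))"
    using b by (rule poly_bounded_mono) (use bit_length_arith_fun in auto)
  ultimately show ?thesis unfolding evaluates_int_def by blast
qed

lemmas evaluates_int_plus = evaluates_int_op[where f = Plus, unfolded arith_fun.simps]
lemmas evaluates_int_minus = evaluates_int_op[where f = Minus, unfolded arith_fun.simps]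
lemmas evaluates_int_times = evaluates_int_op[where f = Times, unfolded arith_fun.simps]
lemmas evaluates_int_divide = evaluates_int_op[where f = Divide, unfolded arith_fun.simps]
lemmas evaluates_int_less = evaluates_int_op[where f = Less, unfolded arith_fun.simps]

lemma evaluates_nat_op:
  assumes "evaluates_nat I sz p E a" and "evaluates_nat I sz q E b"
    and "\<And>i. i \<in> I \<Longrightarrow> arith_fun f (int (a i)) (int (b i)) = int (c i)"
    and "poly_bounded I sz c"
  shows "evaluates_nat I sz (op f p q) E c"
  by (rule evaluates_nat_of_int[OF evaluates_int_op[OF evaluates_int_of_nat[OF assms(1)]
    evaluates_int_of_nat[OF assms(2)]] assms(4) assms(3)])

lemma evaluates_nat_plus:
  assumes "evaluates_nat I sz p E a" and "evaluates_nat I sz q E b"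
  shows "evaluates_nat I sz (op Plus p q) E (\<lambda>i. a i + b i)"
  by (rule evaluates_nat_op[OF assms])
    (use assms poly_bounded_add in \<open>auto simp: evaluates_nat_def\<close>)

lemma evaluates_nat_times:
  assumes "evaluates_nat I sz p E a" and "evaluates_nat I sz q E b"
  shows "evaluates_nat I sz (op Times p q) E (\<lambda>i. a i * b i)"
  by (rule evaluates_nat_op[OF assms])
    (use assms poly_bounded_mult in \<open>auto simp: evaluates_nat_def\<close>)

lemma evaluates_nat_minus:
  assumes "evaluates_nat I sz p E a" and "evaluates_nat I sz q E b"
    and "\<And>i. i \<in> I \<Longrightarrow> b i \<le> a i"
  shows "evaluates_nat I sz (op Minus p q) E (\<lambda>i. a i - b i)"
  by (rule evaluates_nat_op[OF assms(1,2)])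
    (use assms in \<open>auto simp: evaluates_nat_def of_nat_diff intro: poly_bounded_mono\<close>)

lemma evaluates_nat_div:
  assumes "evaluates_nat I sz p E a" and "evaluates_nat I sz q E b"
  shows "evaluates_nat I sz (op Divide p q) E (\<lambda>i. a i div b i)"
  by (rule evaluates_nat_op[OF assms])
    (use assms in \<open>auto simp: evaluates_nat_def zdiv_int intro: poly_bounded_mono\<close>)

definition remainder :: "prog \<Rightarrow> prog \<Rightarrow> prog" where
  "remainder p q = op Minus p (op Times (op Divide p q) q)"

lemma evaluates_nat_remainder:
  assumes "evaluates_nat I sz p E a" and "evaluates_nat I sz q E b"
  shows "evaluates_nat I sz (remainder p q) E (\<lambda>i. a i mod b i)"
proof -
  have "evaluates_nat I sz (remainder p q) E (\<lambda>i. a i - a i div b i * b i)"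
    unfolding remainder_def
    by (intro evaluates_nat_minus evaluates_nat_times evaluates_nat_div assms) simp
  then show ?thesis by (simp add: minus_div_mult_eq_mod)
qed

lemma evaluates_int_Cond:
  assumes "evaluates I sz c E (\<lambda>i. Atom (if P i then 1 else 0))"
    and "evaluates_int I sz p E v" and "evaluates_int I sz q E w"
  shows "evaluates_int I sz (Cond c p q) E (\<lambda>i. if P i then v i else w i)"
proof -
  have "evaluates I sz (Cond c p q) E (\<lambda>i. if P i then Atom (v i) else Atom (w i))"
    by (rule evaluates_Cond[OF assms(1)]; rule evaluates_subset[OF evaluates_int_imp])
      (use assms in auto)
  then have "evaluates I sz (Cond c p q) E (\<lambda>i. Atom (if P i then v i else w i))"
    by (rule evaluates_cong) auto
  moreover have "poly_bounded I sz (\<lambda>i. bit_length (if P i then v i else w i))"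
  proof (rule poly_bounded_mono)
    show "poly_bounded I sz (\<lambda>i. bit_length (v i) + bit_length (w i))"
      using assms unfolding evaluates_int_def by (intro poly_bounded_add) auto
  qed auto
  ultimately show ?thesis unfolding evaluates_int_def by blast
qed

section \<open>Loops\<close>

text \<open>Inside a loop body the environment has the form \<open>Node (Node E var) acc\<close>;
  two steps to the left recover the enclosing environment \<open>E\<close>.\<close>

definition outer :: "prog \<Rightarrow> prog" where
  "outer p = Seq (Seq Left Left) p"

lemma evaluates_outer:
  assumes "evaluates I sz p E v"
  shows "evaluates (Sigma I B) (\<lambda>x. sz (fst x)) (outer p)
    (\<lambda>x. Node (Node (E (fst x)) (u x)) (w x)) (\<lambda>x. v (fst x))"
  unfolding outer_def
  by (rule evaluates_Seq[OF evaluates_Seq[OF evaluates_Left evaluates_Left]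
    evaluates_reindex[OF assms]]) auto

lemma evaluates_int_outer:
  assumes "evaluates_int I sz p E v"
  shows "evaluates_int (Sigma I B) (\<lambda>x. sz (fst x)) (outer p)
    (\<lambda>x. Node (Node (E (fst x)) (u x)) (w x)) (\<lambda>x. v (fst x))"
  using assms unfolding evaluates_int_def
  by (auto intro: evaluates_outer poly_bounded_fst[of I sz "\<lambda>i. bit_length (v i)"])

lemma evaluates_nat_outer:
  assumes "evaluates_nat I sz p E v"
  shows "evaluates_nat (Sigma I B) (\<lambda>x. sz (fst x)) (outer p)
    (\<lambda>x. Node (Node (E (fst x)) (u x)) (w x)) (\<lambda>x. v (fst x))"
  using assms unfolding evaluates_nat_def
  by (auto intro: evaluates_outer[of I sz p E "\<lambda>i. Atom (int (v i))"] poly_bounded_fst)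

abbreviation (input) loop_var :: prog where
  "loop_var \<equiv> Seq Left Right"

text \<open>The loop variable counts down from the number of iterations to 1.\<close>

definition for_loop :: "prog \<Rightarrow> prog \<Rightarrow> prog \<Rightarrow> prog" where
  "for_loop N init body =
     Seq (Fork (Fork Skip N) init)
       (Seq (While (op Less (Lit 0) loop_var)
               (Fork (Fork (Seq Left Left) (op Minus loop_var (Lit 1))) body))
         Right)"

lemma evaluates_for_loop:
  assumes N: "evaluates_nat I sz N E n"
    and init: "evaluates I sz init E (\<lambda>i. acc i 0)"
    and body: "evaluates (SIGMA i:I. {..<n i}) (\<lambda>x. sz (fst x)) body
      (\<lambda>x. Node (Node (E (fst x)) (Atom (int (n (fst x) - snd x)))) (acc (fst x) (snd x)))
      (\<lambda>x. acc (fst x) (Suc (snd x)))"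
  shows "evaluates I sz (for_loop N init body) E (\<lambda>i. acc i (n i))"
proof -
  define S where "S i j = Node (Node (E i) (Atom (int (n i - j)))) (acc i j)" for i j
  have n: "poly_bounded I sz n" using N unfolding evaluates_nat_def by blast
  have var: "evaluates_int (SIGMA i:I. B i) (\<lambda>x. sz (fst x)) loop_var (\<lambda>x. S (fst x) (snd x))
      (\<lambda>x. int (n (fst x) - snd x))" for B
  proof -
    have "poly_bounded (SIGMA i:I. B i) (\<lambda>x. sz (fst x)) (\<lambda>x. bit_length (int (n (fst x) - snd x)))"
      using poly_bounded_fst[OF n, of B]
      by (rule poly_bounded_mono) (rule order_trans[OF bit_length_int_le], simp)
    moreover have "evaluates (SIGMA i:I. B i) (\<lambda>x. sz (fst x)) loop_var (\<lambda>x. S (fst x) (snd x))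
      (\<lambda>x. Atom (int (n (fst x) - snd x)))"
      unfolding S_def by (rule evaluates_Seq evaluates_Left evaluates_Right)+
    ultimately show ?thesis unfolding evaluates_int_def by blast
  qed
  have loop: "evaluates I sz (While (op Less (Lit 0) loop_var)
      (Fork (Fork (Seq Left Left) (op Minus loop_var (Lit 1))) body))
      (\<lambda>i. S i 0) (\<lambda>i. S i (n i))"
  proof (rule evaluates_While[OF _ _ n])
    show "evaluates (SIGMA i:I. {..n i}) (\<lambda>x. sz (fst x)) (op Less (Lit 0) loop_var)
        (\<lambda>x. S (fst x) (snd x)) (\<lambda>x. Atom (if snd x < n (fst x) then 1 else 0))"
      by (rule evaluates_int_imp, rule evaluates_int_cong,
          rule evaluates_int_less[OF evaluates_int_Lit var]) auto
    have "evaluates (SIGMA i:I. {..<n i}) (\<lambda>x. sz (fst x)) (op Minus loop_var (Lit 1))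
        (\<lambda>x. S (fst x) (snd x)) (\<lambda>x. Atom (int (n (fst x) - Suc (snd x))))"
      by (rule evaluates_int_imp, rule evaluates_int_cong,
          rule evaluates_int_minus[OF var evaluates_int_Lit]) auto
    then show "evaluates (SIGMA i:I. {..<n i}) (\<lambda>x. sz (fst x))
        (Fork (Fork (Seq Left Left) (op Minus loop_var (Lit 1))) body)
        (\<lambda>x. S (fst x) (snd x)) (\<lambda>x. S (fst x) (Suc (snd x)))"
      unfolding S_def
      by (intro evaluates_Fork body evaluates_Seq[OF evaluates_Left evaluates_Left])
  qed
  have enter: "evaluates I sz (Fork (Fork Skip N) init) E (\<lambda>i. S i 0)"
    unfolding S_def
    by (intro evaluates_Fork evaluates_Skip init) (use evaluates_nat_imp[OF N] in simp)
  have leave: "evaluates I sz Right (\<lambda>i. S i (n i)) (\<lambda>i. acc i (n i))"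
    unfolding S_def by (rule evaluates_Right)
  show ?thesis unfolding for_loop_def
    by (rule evaluates_Seq[OF enter evaluates_Seq[OF loop leave]])
qed

text \<open>The loop variable is the list of the elements that have not yet been processed.\<close>

definition fold_loop :: "prog \<Rightarrow> prog \<Rightarrow> prog \<Rightarrow> prog" where
  "fold_loop xs init body =
     Seq (Fork (Fork Skip xs) init)
       (Seq (While (Seq loop_var Is_Node)
               (Fork (Fork (Seq Left Left) (Seq loop_var Right)) body))
         Right)"

abbreviation (input) element :: prog where
  "element \<equiv> Seq loop_var Left"

lemma enc_list_drop:
  "j < length xs \<Longrightarrow> enc_list (drop j xs) = Node (xs ! j) (enc_list (drop (Suc j) xs))"
  by (simp add: Cons_nth_drop_Suc[symmetric])

lemma evaluates_element:
  "evaluates (SIGMA i:I. {..<length (xs i)}) sz element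
     (\<lambda>x. Node (Node (u x) (enc_list (drop (snd x) (xs (fst x))))) (w x))
     (\<lambda>x. xs (fst x) ! snd x)"
proof -
  have "evaluates (SIGMA i:I. {..<length (xs i)}) sz element
     (\<lambda>x. Node (Node (u x) (Node (xs (fst x) ! snd x)
        (enc_list (drop (Suc (snd x)) (xs (fst x)))))) (w x))
     (\<lambda>x. xs (fst x) ! snd x)"
    by (rule evaluates_Seq evaluates_Left evaluates_Right)+
  then show ?thesis by (rule evaluates_cong) (auto simp: enc_list_drop)
qed

lemma evaluates_fold_loop:
  assumes p: "evaluates I sz p E (\<lambda>i. enc_list (xs i))"
    and init: "evaluates I sz init E (\<lambda>i. acc i 0)"
    and body: "evaluates (SIGMA i:I. {..<length (xs i)}) (\<lambda>x. sz (fst x)) body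
      (\<lambda>x. Node (Node (E (fst x)) (enc_list (drop (snd x) (xs (fst x))))) (acc (fst x) (snd x)))
      (\<lambda>x. acc (fst x) (Suc (snd x)))"
    and n: "poly_bounded I sz (\<lambda>i. length (xs i))"
  shows "evaluates I sz (fold_loop p init body) E (\<lambda>i. acc i (length (xs i)))"
proof -
  define S where "S i j = Node (Node (E i) (enc_list (drop j (xs i)))) (acc i j)" for i j
  have var: "evaluates B sz' loop_var (\<lambda>x. S (fst x) (snd x))
      (\<lambda>x. enc_list (drop (snd x) (xs (fst x))))" for B sz'
      unfolding S_def by (rule evaluates_Seq evaluates_Left evaluates_Right)+
  have loop: "evaluates I sz (While (Seq loop_var Is_Node)
      (Fork (Fork (Seq Left Left) (Seq loop_var Right)) body))
      (\<lambda>i. S i 0) (\<lambda>i. S i (length (xs i)))"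
  proof (rule evaluates_While[OF _ _ n])
    \<comment> \<open>The empty list is encoded as an atom, so the node test detects whether
      elements remain.\<close>
    show "evaluates (SIGMA i:I. {..length (xs i)}) (\<lambda>x. sz (fst x)) (Seq loop_var Is_Node)
        (\<lambda>x. S (fst x) (snd x)) (\<lambda>x. Atom (if snd x < length (xs (fst x)) then 1 else 0))"
      by (rule evaluates_cong, rule evaluates_Seq[OF var evaluates_Is_Node])
         (auto simp: enc_list_drop not_less)
    have "evaluates (SIGMA i:I. {..<length (xs i)}) (\<lambda>x. sz (fst x)) Right
        (\<lambda>x. Node (xs (fst x) ! snd x) (enc_list (drop (Suc (snd x)) (xs (fst x)))))
        (\<lambda>x. enc_list (drop (Suc (snd x)) (xs (fst x))))"
      by (rule evaluates_Right)
    then have "evaluates (SIGMA i:I. {..<length (xs i)}) (\<lambda>x. sz (fst x)) Right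
        (\<lambda>x. enc_list (drop (snd x) (xs (fst x))))
        (\<lambda>x. enc_list (drop (Suc (snd x)) (xs (fst x))))"
      by (rule evaluates_cong) (auto simp: enc_list_drop)
    then have "evaluates (SIGMA i:I. {..<length (xs i)}) (\<lambda>x. sz (fst x)) (Seq loop_var Right)
        (\<lambda>x. S (fst x) (snd x)) (\<lambda>x. enc_list (drop (Suc (snd x)) (xs (fst x))))"
      by (rule evaluates_Seq[OF var])
    then show "evaluates (SIGMA i:I. {..<length (xs i)}) (\<lambda>x. sz (fst x))
        (Fork (Fork (Seq Left Left) (Seq loop_var Right)) body)
        (\<lambda>x. S (fst x) (snd x)) (\<lambda>x. S (fst x) (Suc (snd x)))"
      unfolding S_def
      by (intro evaluates_Fork body evaluates_Seq[OF evaluates_Left evaluates_Left])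
  qed
  have enter: "evaluates I sz (Fork (Fork Skip p) init) E (\<lambda>i. S i 0)"
    unfolding S_def by (intro evaluates_Fork evaluates_Skip init) (use p in simp)
  have leave: "evaluates I sz Right (\<lambda>i. S i (length (xs i))) (\<lambda>i. acc i (length (xs i)))"
    unfolding S_def by (rule evaluates_Right)
  show ?thesis unfolding fold_loop_def
    by (rule evaluates_Seq[OF enter evaluates_Seq[OF loop leave]])
qed

section \<open>List operations as folds\<close>

definition list_length :: "prog \<Rightarrow> prog" where
  "list_length p = fold_loop p (Lit 0) (op Plus Right (Lit 1))"

lemma evaluates_list_length:
  assumes "evaluates I sz p E (\<lambda>i. enc_list (xs i))" and n: "poly_bounded I sz (\<lambda>i. length (xs i))"
  shows "evaluates_nat I sz (list_length p) E (\<lambda>i. length (xs i))"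
proof -
  have "evaluates I sz (list_length p) E (\<lambda>i. Atom (int (length (xs i))))"
    unfolding list_length_def
  proof (rule evaluates_fold_loop[OF assms(1) _ _ n, where acc = "\<lambda>i j. Atom (int j)"])
    have *: "poly_bounded (SIGMA i:I. {..<length (xs i)}) (\<lambda>x. sz (fst x)) snd"
      using poly_bounded_fst[OF n, of "\<lambda>i. {..<length (xs i)}"]
      by (rule poly_bounded_mono) auto
    show "evaluates (SIGMA i:I. {..<length (xs i)}) (\<lambda>x. sz (fst x)) (op Plus Right (Lit 1))
      (\<lambda>x. Node (Node (E (fst x)) (enc_list (drop (snd x) (xs (fst x))))) (Atom (int (snd x))))
      (\<lambda>x. Atom (int (Suc (snd x))))"
      by (rule evaluates_int_imp, rule evaluates_int_cong, rule evaluates_int_plus,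
          rule evaluates_int_of_nat, rule evaluates_nat_Right[OF *], rule evaluates_int_Lit) simp
  qed (simp add: evaluates_Lit)
  with n show ?thesis unfolding evaluates_nat_def by blast
qed

definition reverse :: "prog \<Rightarrow> prog" where
  "reverse p = fold_loop p (Lit 0) (Fork element Right)"

lemma evaluates_reverse:
  assumes "evaluates I sz p E (\<lambda>i. enc_list (xs i))" and n: "poly_bounded I sz (\<lambda>i. length (xs i))"
  shows "evaluates I sz (reverse p) E (\<lambda>i. enc_list (rev (xs i)))"
proof -
  have "evaluates I sz (reverse p) E (\<lambda>i. enc_list (rev (take (length (xs i)) (xs i))))"
    unfolding reverse_def
  proof (rule evaluates_fold_loop[OF assms(1) _ _ n])
    have "evaluates (SIGMA i:I. {..<length (xs i)}) (\<lambda>x. sz (fst x)) (Fork element Right)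
      (\<lambda>x. Node (Node (E (fst x)) (enc_list (drop (snd x) (xs (fst x)))))
         (enc_list (rev (take (snd x) (xs (fst x))))))
      (\<lambda>x. Node (xs (fst x) ! snd x) (enc_list (rev (take (snd x) (xs (fst x))))))"
      by (intro evaluates_Fork evaluates_element evaluates_Right)
    then show "evaluates (SIGMA i:I. {..<length (xs i)}) (\<lambda>x. sz (fst x)) (Fork element Right)
      (\<lambda>x. Node (Node (E (fst x)) (enc_list (drop (snd x) (xs (fst x)))))
         (enc_list (rev (take (snd x) (xs (fst x))))))
      (\<lambda>x. enc_list (rev (take (Suc (snd x)) (xs (fst x)))))"
      by (rule evaluates_cong) (auto simp: take_Suc_conv_app_nth)
  qed (simp add: evaluates_Lit)
  then show ?thesis by simp
qed

text \<open>The fold prepends its results and so reverses the order; reversing the input beforehand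
  compensates. The body therefore meets the elements of \<open>rev xs\<close>.\<close>

definition map_loop :: "prog \<Rightarrow> prog \<Rightarrow> prog" where
  "map_loop p body = fold_loop (reverse p) (Lit 0) (Fork body Right)"

lemma evaluates_map_loop:
  assumes p: "evaluates I sz p E (\<lambda>i. enc_list (map g (xs i)))"
    and n: "poly_bounded I sz (\<lambda>i. length (xs i))"
    and body: "\<And>u. evaluates (SIGMA i:I. {..<length (xs i)}) (\<lambda>x. sz (fst x)) body
      (\<lambda>x. Node (Node (E (fst x)) (enc_list (drop (snd x) (map g (rev (xs (fst x))))))) (u x))
      (\<lambda>x. f (fst x) (rev (xs (fst x)) ! snd x))"
  shows "evaluates I sz (map_loop p body) E (\<lambda>i. enc_list (map (f i) (xs i)))"
proof -
  define ys where "ys i = map g (rev (xs i))" for i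
  have len: "length (ys i) = length (xs i)" for i by (simp add: ys_def)
  define acc where "acc i j = enc_list (rev (take j (map (f i) (rev (xs i)))))" for i j
  have "evaluates I sz (reverse p) E (\<lambda>i. enc_list (rev (map g (xs i))))"
    using n by (intro evaluates_reverse[OF p]) simp
  then have reverse: "evaluates I sz (reverse p) E (\<lambda>i. enc_list (ys i))"
    by (simp add: ys_def rev_map)
  have "evaluates (SIGMA i:I. {..<length (xs i)}) (\<lambda>x. sz (fst x)) (Fork body Right)
      (\<lambda>x. Node (Node (E (fst x)) (enc_list (drop (snd x) (ys (fst x))))) (acc (fst x) (snd x)))
      (\<lambda>x. Node (f (fst x) (rev (xs (fst x)) ! snd x)) (acc (fst x) (snd x)))"
    unfolding ys_def by (intro evaluates_Fork body evaluates_Right)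
  then have "evaluates (SIGMA i:I. {..<length (ys i)}) (\<lambda>x. sz (fst x)) (Fork body Right)
      (\<lambda>x. Node (Node (E (fst x)) (enc_list (drop (snd x) (ys (fst x))))) (acc (fst x) (snd x)))
      (\<lambda>x. acc (fst x) (Suc (snd x)))"
    unfolding len by (rule evaluates_cong) (auto simp: acc_def take_Suc_conv_app_nth)
  moreover have "evaluates I sz (Lit 0) E (\<lambda>i. acc i 0)" by (simp add: acc_def evaluates_Lit)
  ultimately have "evaluates I sz (map_loop p body) E (\<lambda>i. acc i (length (ys i)))"
    unfolding map_loop_def using n by (intro evaluates_fold_loop[OF reverse]) (simp_all add: len)
  then show ?thesis by (simp add: acc_def len rev_map)
qed

definition pow :: "prog \<Rightarrow> prog \<Rightarrow> prog" where
  "pow p q = for_loop q (Lit 1) (op Times Right (outer p))"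

text \<open>The result can have about \<open>n i\<close> times as many bits as the base, so the
  exponent has to be bounded in value and not only in length.\<close>

lemma evaluates_int_pow:
  assumes p: "evaluates_int I sz p E a" and q: "evaluates_nat I sz q E n"
  shows "evaluates_int I sz (pow p q) E (\<lambda>i. a i ^ n i)"
proof -
  have n: "poly_bounded I sz n" and a: "poly_bounded I sz (\<lambda>i. bit_length (a i))"
    using p q unfolding evaluates_int_def evaluates_nat_def by auto
  have b: "poly_bounded I sz (\<lambda>i. Suc (n i * bit_length (a i)))"
    by (intro poly_bounded_Suc poly_bounded_mult n a)
  have "evaluates I sz (pow p q) E (\<lambda>i. Atom (a i ^ n i))"
    unfolding pow_def
  proof (rule evaluates_for_loop[OF q, where acc = "\<lambda>i j. Atom (a i ^ j)"])
    have "poly_bounded (SIGMA i:I. {..<n i}) (\<lambda>x. sz (fst x)) (\<lambda>x. bit_length (a (fst x) ^ snd x))"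
      using poly_bounded_fst[OF b, of "\<lambda>i. {..<n i}"]
    proof (rule poly_bounded_mono)
      fix x assume "x \<in> (SIGMA i:I. {..<n i})"
      then have "Suc (snd x * bit_length (a (fst x))) \<le> Suc (n (fst x) * bit_length (a (fst x)))"
        by (intro Suc_leI le_imp_less_Suc mult_right_mono) auto
      then show "bit_length (a (fst x) ^ snd x) \<le> Suc (n (fst x) * bit_length (a (fst x)))"
        by (rule order_trans[OF bit_length_power])
    qed
    then show "evaluates (SIGMA i:I. {..<n i}) (\<lambda>x. sz (fst x)) (op Times Right (outer p))
      (\<lambda>x. Node (Node (E (fst x)) (Atom (int (n (fst x) - snd x)))) (Atom (a (fst x) ^ snd x)))
      (\<lambda>x. Atom (a (fst x) ^ Suc (snd x)))"
      unfolding power_Suc2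
      by (intro evaluates_int_imp evaluates_int_times evaluates_int_Right evaluates_int_outer p)
  qed (simp add: evaluates_Lit)
  moreover have "poly_bounded I sz (\<lambda>i. bit_length (a i ^ n i))"
    using b by (rule poly_bounded_mono) (rule bit_length_power)
  ultimately show ?thesis unfolding evaluates_int_def by blast
qed

section \<open>Computing weights and objective\<close>

lemma data_size_le_enc_list: "u \<in> set us \<Longrightarrow> data_size u \<le> data_size (enc_list us)"
  by (induction us) auto

lemma length_le_data_size: "length us \<le> data_size (enc_list us)"
  by (induction us) auto

lemma evaluates_int_fst_quotient:
  assumes "evaluates I sz p E (\<lambda>i. enc_rat (q i))" and "poly_bounded I sz (\<lambda>i. data_size (enc_rat (q i)))"
  shows "evaluates_int I sz (Seq p Left) E (\<lambda>i. fst (quotient_of (q i)))"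
  unfolding evaluates_int_def
proof
  show "poly_bounded I sz (\<lambda>i. bit_length (fst (quotient_of (q i))))"
    using assms(2) by (rule poly_bounded_mono) (simp add: enc_rat_def)
qed (rule evaluates_Seq[OF assms(1)], unfold enc_rat_def, rule evaluates_Left)

lemma evaluates_int_snd_quotient:
  assumes "evaluates I sz p E (\<lambda>i. enc_rat (q i))" and "poly_bounded I sz (\<lambda>i. data_size (enc_rat (q i)))"
  shows "evaluates_int I sz (Seq p Right) E (\<lambda>i. snd (quotient_of (q i)))"
  unfolding evaluates_int_def
proof
  show "poly_bounded I sz (\<lambda>i. bit_length (snd (quotient_of (q i))))"
    using assms(2) by (rule poly_bounded_mono) (simp add: enc_rat_def)
qed (rule evaluates_Seq[OF assms(1)], unfold enc_rat_def, rule evaluates_Right)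

definition minimum :: "prog \<Rightarrow> prog \<Rightarrow> prog" where
  "minimum p q = Cond (op Less p q) p q"

lemma evaluates_int_minimum:
  assumes "evaluates_int I sz p E a" and "evaluates_int I sz q E b"
  shows "evaluates_int I sz (minimum p q) E (\<lambda>i. min (a i) (b i))"
  unfolding minimum_def
  by (rule evaluates_int_cong[OF evaluates_int_Cond[OF
        evaluates_int_imp[OF evaluates_int_less[OF assms]] assms]]) auto

subsection \<open>Laplace transforms of the discretized distributions\<close>

definition grid :: "nat \<Rightarrow> nat \<Rightarrow> real \<Rightarrow> nat" where
  "grid N J v = min J (nat \<lfloor>v * real N\<rfloor>)"

lemma floor_of_rat_mult:
  assumes "quotient_of v = (a, b)"
  shows "\<lfloor>(of_rat v :: real) * real N\<rfloor> = a * int N div b"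
proof -
  have "(of_rat v :: real) * real N = of_int (a * int N) / of_int b"
    using quotient_of_div[OF assms] by (simp add: of_rat_divide)
  then show ?thesis using floor_divide_of_int_eq by metis
qed

text \<open>Replaces a real floor by an integer division that a program can carry out. For
  \<open>0 \<le> v\<close> the conversion by \<open>nat\<close> loses nothing.\<close>

lemma int_grid:
  assumes "0 \<le> v"
  shows "int (grid N J (of_rat v)) =
    min (int J) (fst (quotient_of v) * int N div snd (quotient_of v))"
proof -
  have "0 \<le> \<lfloor>(of_rat v :: real) * real N\<rfloor>" using assms by simp
  then show ?thesis
    using floor_of_rat_mult[of v "fst (quotient_of v)" "snd (quotient_of v)" N]
    by (simp add: grid_def)
qed

text \<open>One summand \<open>q (1 - 1 / N) ^ (k * grid N J v)\<close> is added to the fraction \<open>a / b\<close>.\<close>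

fun transform_step :: "nat \<Rightarrow> nat \<Rightarrow> nat \<Rightarrow> rat \<times> rat \<Rightarrow> int \<times> int \<Rightarrow> int \<times> int" where
  "transform_step k N J (v, q) (a, b) =
     (let t = k * grid N J (of_rat v); d = snd (quotient_of q) * int N ^ t
      in (a * d + b * (fst (quotient_of q) * (int N - 1) ^ t), b * d))"

definition transform :: "nat \<Rightarrow> nat \<Rightarrow> nat \<Rightarrow> distribution \<Rightarrow> int \<times> int" where
  "transform k N J d = fold (transform_step k N J) d (0, 1)"

definition bits :: "int \<times> int \<Rightarrow> nat" where
  "bits r = max (bit_length (fst r)) (bit_length (snd r))"

text \<open>Fractions are never reduced, yet the lengths merely add up: a step multiplies by numbers
  of \<open>O(s + k J N)\<close> bits, because truncation at \<open>J\<close> keeps the exponent at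
  most \<open>k * J\<close>.\<close>

lemma bits_transform_step:
  assumes "data_size (enc_rat q) \<le> s"
  shows "bits (transform_step k N J (v, q) r) \<le> bits r + (s + 2 + k * J * Suc N)"
proof -
  obtain a b where r: "r = (a, b)" by (cases r)
  define t where "t = k * grid N J (of_rat v)"
  define d where "d = snd (quotient_of q) * int N ^ t"
  define e where "e = fst (quotient_of q) * (int N - 1) ^ t"
  have t: "t * m \<le> k * J * Suc N" if "m \<le> Suc N" for m
    unfolding t_def using that by (intro mult_mono) (auto simp: grid_def)
  have "bit_length (int N) \<le> Suc N" using bit_length_int_le[of N] by simp
  then have "bit_length (int N ^ t) \<le> Suc (k * J * Suc N)"
    using bit_length_power[of "int N" t] t[of "bit_length (int N)"] by linarith
  moreover have "bit_length (snd (quotient_of q)) \<le> s" using assms by (simp add: enc_rat_def)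
  ultimately have d: "bit_length d \<le> s + 1 + k * J * Suc N"
    using bit_length_mult[of "snd (quotient_of q)" "int N ^ t"] by (simp add: d_def)
  \<comment> \<open>Comparing with \<open>Suc N\<close> also covers \<open>N = 0\<close>, where
    \<open>int N - 1\<close> is \<open>-1\<close>.\<close>
  have "\<bar>int N - 1\<bar> \<le> \<bar>int (Suc N)\<bar>" by linarith
  then have "bit_length (int N - 1) \<le> Suc N"
    using bit_length_mono bit_length_int_le order_trans by blast
  then have "bit_length ((int N - 1) ^ t) \<le> Suc (k * J * Suc N)"
    using bit_length_power[of "int N - 1" t] t[of "bit_length (int N - 1)"] by linarith
  moreover have "bit_length (fst (quotient_of q)) \<le> s" using assms by (simp add: enc_rat_def)
  ultimately have e: "bit_length e \<le> s + 1 + k * J * Suc N"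
    using bit_length_mult[of "fst (quotient_of q)" "(int N - 1) ^ t"] by (simp add: e_def)
  have ab: "bit_length a \<le> bits r" "bit_length b \<le> bits r" by (simp_all add: bits_def r)
  have "bit_length (a * d + b * e) \<le> Suc (max (bit_length (a * d)) (bit_length (b * e)))"
    by (intro bit_length_le_add abs_triangle_ineq)
  also have "\<dots> \<le> bits r + (s + 2 + k * J * Suc N)"
    using bit_length_mult[of a d] bit_length_mult[of b e] ab d e by simp
  finally have "bit_length (a * d + b * e) \<le> bits r + (s + 2 + k * J * Suc N)" .
  moreover have "bit_length (b * d) \<le> bits r + (s + 2 + k * J * Suc N)"
    using bit_length_mult[of b d] ab d by simp
  moreover have "transform_step k N J (v, q) r = (a * d + b * e, b * d)"
    by (simp add: r d_def e_def t_def Let_def)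
  ultimately show ?thesis by (simp add: bits_def)
qed

lemma bits_fold_transform_step:
  assumes "\<And>v q. (v, q) \<in> set d \<Longrightarrow> data_size (enc_rat q) \<le> s"
  shows "bits (fold (transform_step k N J) d r) \<le> bits r + length d * (s + 2 + k * J * Suc N)"
  using assms
proof (induction d arbitrary: r)
  case (Cons vq d)
  obtain v q where vq: "vq = (v, q)" by (cases vq)
  let ?c = "s + 2 + k * J * Suc N"
  have "bits (fold (transform_step k N J) (vq # d) r)
      \<le> bits (transform_step k N J vq r) + length d * ?c"
    using Cons.IH[of "transform_step k N J vq r"] Cons.prems by auto
  also have "\<dots> \<le> bits r + ?c + length d * ?c"
    using bits_transform_step[of q s k N J v r] Cons.prems[of v q] vq by simp
  finally show ?case by simp
qed simp

abbreviation enc_distribution :: "distribution \<Rightarrow> data" where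
  "enc_distribution d \<equiv> enc_list (map (\<lambda>(v, q). Node (enc_rat v) (enc_rat q)) d)"

lemma data_size_enc_distribution:
  assumes "(v, q) \<in> set d"
  shows "data_size (enc_rat v) \<le> data_size (enc_distribution d)"
    and "data_size (enc_rat q) \<le> data_size (enc_distribution d)"
proof -
  have "data_size (Node (enc_rat v) (enc_rat q)) \<le> data_size (enc_distribution d)"
    by (rule data_size_le_enc_list) (use assms in force)
  then show "data_size (enc_rat v) \<le> data_size (enc_distribution d)"
    "data_size (enc_rat q) \<le> data_size (enc_distribution d)" by auto
qed

text \<open>The \<open>let\<close> bindings abbreviate program text. Each occurrence is evaluated
  anew, which costs only a constant factor.\<close>

definition transform_prog :: "nat \<Rightarrow> prog \<Rightarrow> prog \<Rightarrow> prog \<Rightarrow> prog" where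
  "transform_prog k N J d =
     (let v = Seq element Left; q = Seq element Right;
          t = op Times (Lit (int k)) (minimum (outer J)
                (op Divide (op Times (Seq v Left) (outer N)) (Seq v Right)));
          d' = op Times (Seq q Right) (pow (outer N) t);
          e = op Times (Seq q Left) (pow (op Minus (outer N) (Lit 1)) t);
          a = Seq Right Left; b = Seq Right Right
      in fold_loop d (Fork (Lit 0) (Lit 1))
           (Fork (op Plus (op Times a d') (op Times b e)) (op Times b d')))"

text \<open>The loop invariant is the fraction accumulated over the first \<open>j\<close> entries.
  Its length is a second conclusion because later arithmetic on the fraction is charged by
  length.\<close>

lemma evaluates_transform_prog:
  assumes N: "evaluates_nat I sz pN E N" and J: "evaluates_nat I sz pJ E J"
    and d: "evaluates I sz pd E (\<lambda>i. enc_distribution (d i))"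
    and size: "poly_bounded I sz (\<lambda>i. data_size (enc_distribution (d i)))"
    and nonneg: "\<And>i v q. i \<in> I \<Longrightarrow> (v, q) \<in> set (d i) \<Longrightarrow> 0 \<le> v"
  shows "evaluates I sz (transform_prog k pN pJ pd) E
      (\<lambda>i. Node (Atom (fst (transform k (N i) (J i) (d i)))) (Atom (snd (transform k (N i) (J i) (d i)))))"
    and "poly_bounded I sz (\<lambda>i. bits (transform k (N i) (J i) (d i)))"
proof -
  define part where "part i j = fold (transform_step k (N i) (J i)) (take j (d i)) (0, 1)" for i j
  let ?enc = "\<lambda>(v, q). Node (enc_rat v) (enc_rat q)"
  have length: "poly_bounded I sz (\<lambda>i. length (map ?enc (d i)))"
    using size by (rule poly_bounded_mono) (rule length_le_data_size)
  have bits1: "bits (0, 1) = 1"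
    using bit_length_le_iff[of 1 1] bit_length_le_iff[of 1 0] by (auto simp: bits_def)
  have N': "poly_bounded I sz N" and J': "poly_bounded I sz J"
    using N J unfolding evaluates_nat_def by auto
  let ?bound = "\<lambda>i. 1 + length (map ?enc (d i)) *
    (data_size (enc_distribution (d i)) + 2 + k * J i * Suc (N i))"
  have bound: "poly_bounded I sz ?bound"
    by (intro poly_bounded_add poly_bounded_const poly_bounded_mult poly_bounded_Suc N' J' length size)
  have part_bits: "bits (part i j) \<le> ?bound i" for i j
  proof -
    have "bits (part i j) \<le> bits (0, 1) + length (take j (d i)) *
        (data_size (enc_distribution (d i)) + 2 + k * J i * Suc (N i))"
      unfolding part_def
      by (rule bits_fold_transform_step) (use data_size_enc_distribution(2) in \<open>auto dest: in_set_takeD\<close>)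
    also have "\<dots> \<le> ?bound i" unfolding bits1 by (intro add_mono mult_right_mono) auto
    finally show ?thesis .
  qed
  show "poly_bounded I sz (\<lambda>i. bits (transform k (N i) (J i) (d i)))"
    using bound
  proof (rule poly_bounded_mono)
    show "bits (transform k (N i) (J i) (d i)) \<le> ?bound i" for i
      using part_bits[of i "length (d i)"] unfolding part_def transform_def by simp
  qed
  define X where "X = (SIGMA i:I. {..<length (map ?enc (d i))})"
  define sz' where "sz' x = sz (fst x)" for x :: "'a \<times> nat"
  define F where "F x = Node (Node (E (fst x)) (enc_list (drop (snd x) (map ?enc (d (fst x))))))
    (Node (Atom (fst (part (fst x) (snd x)))) (Atom (snd (part (fst x) (snd x)))))" for x
  define v q where "v x = fst (d (fst x) ! snd x)" and "q x = snd (d (fst x) ! snd x)" for x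
  have vq: "d (fst x) ! snd x = (v x, q x)" "(v x, q x) \<in> set (d (fst x))" if "x \<in> X" for x
    using that nth_mem[of "snd x" "d (fst x)"] by (auto simp: v_def q_def X_def)
  have "evaluates X sz' element F (\<lambda>x. map ?enc (d (fst x)) ! snd x)"
    unfolding X_def F_def by (rule evaluates_element)
  then have el: "evaluates X sz' element F (\<lambda>x. Node (enc_rat (v x)) (enc_rat (q x)))"
    by (rule evaluates_cong) (use vq in \<open>auto simp: X_def\<close>)
  have size': "poly_bounded X sz' (\<lambda>x. data_size (enc_distribution (d (fst x))))"
    unfolding X_def sz'_def using size by (rule poly_bounded_fst)
  have sv: "poly_bounded X sz' (\<lambda>x. data_size (enc_rat (v x)))"
    using size' by (rule poly_bounded_mono) (use vq data_size_enc_distribution in blast)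
  have sq: "poly_bounded X sz' (\<lambda>x. data_size (enc_rat (q x)))"
    using size' by (rule poly_bounded_mono) (use vq data_size_enc_distribution in blast)
  note ev = evaluates_Seq[OF el evaluates_Left] and eq = evaluates_Seq[OF el evaluates_Right]
  have oN: "evaluates_nat X sz' (outer pN) F (\<lambda>x. N (fst x))"
    and oJ: "evaluates_nat X sz' (outer pJ) F (\<lambda>x. J (fst x))"
    unfolding X_def sz'_def F_def using N J by (auto intro: evaluates_nat_outer)
  define pt where "pt = op Times (Lit (int k)) (minimum (outer pJ)
    (op Divide (op Times (Seq (Seq element Left) Left) (outer pN)) (Seq (Seq element Left) Right)))"
  define t where "t x = k * grid (N (fst x)) (J (fst x)) (of_rat (v x))" for x
  have t: "evaluates_nat X sz' pt F t"
    unfolding pt_def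
  proof (rule evaluates_nat_of_int)
    show "evaluates_int X sz' (op Times (Lit (int k)) (minimum (outer pJ) (op Divide
        (op Times (Seq (Seq element Left) Left) (outer pN)) (Seq (Seq element Left) Right))))
      F (\<lambda>x. int k * min (int (J (fst x)))
        (fst (quotient_of (v x)) * int (N (fst x)) div snd (quotient_of (v x))))"
      by (intro evaluates_int_times evaluates_int_Lit evaluates_int_minimum evaluates_int_divide
          evaluates_int_of_nat oJ oN evaluates_int_fst_quotient evaluates_int_snd_quotient ev sv)
    show "poly_bounded X sz' t"
    proof (rule poly_bounded_mono)
      show "poly_bounded X sz' (\<lambda>x. k * J (fst x))"
        unfolding X_def sz'_def by (intro poly_bounded_mult poly_bounded_const poly_bounded_fst J')
    qed (auto simp: t_def grid_def)
    show "int k * min (int (J (fst x)))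
        (fst (quotient_of (v x)) * int (N (fst x)) div snd (quotient_of (v x))) = int (t x)"
      if "x \<in> X" for x
    proof -
      have "0 \<le> v x" using that vq[OF that] by (intro nonneg[of "fst x"]) (auto simp: X_def)
      then show ?thesis by (simp add: t_def int_grid)
    qed
  qed
  have pb: "poly_bounded X sz' (\<lambda>x. bits (part (fst x) (snd x)))"
  proof (rule poly_bounded_mono)
    show "poly_bounded X sz' (\<lambda>x. ?bound (fst x))"
      unfolding X_def sz'_def using bound by (rule poly_bounded_fst)
  qed (rule part_bits)
  have a: "evaluates_int X sz' (Seq Right Left) F (\<lambda>x. fst (part (fst x) (snd x)))"
    unfolding evaluates_int_def F_def
  proof
    show "poly_bounded X sz' (\<lambda>x. bit_length (fst (part (fst x) (snd x))))"
      using pb by (rule poly_bounded_mono) (simp add: bits_def)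
  qed (rule evaluates_Seq[OF evaluates_Right evaluates_Left])
  have b: "evaluates_int X sz' (Seq Right Right) F (\<lambda>x. snd (part (fst x) (snd x)))"
    unfolding evaluates_int_def F_def
  proof
    show "poly_bounded X sz' (\<lambda>x. bit_length (snd (part (fst x) (snd x))))"
      using pb by (rule poly_bounded_mono) (simp add: bits_def)
  qed (rule evaluates_Seq[OF evaluates_Right evaluates_Right])
  let ?d = "\<lambda>x. snd (quotient_of (q x)) * int (N (fst x)) ^ t x"
  let ?e = "\<lambda>x. fst (quotient_of (q x)) * (int (N (fst x)) - 1) ^ t x"
  let ?pd = "op Times (Seq (Seq element Right) Right) (pow (outer pN) pt)"
  let ?pe = "op Times (Seq (Seq element Right) Left) (pow (op Minus (outer pN) (Lit 1)) pt)"
  have pd: "evaluates_int X sz' ?pd F ?d" and pe: "evaluates_int X sz' ?pe F ?e"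
    by (intro evaluates_int_times evaluates_int_pow evaluates_int_snd_quotient evaluates_int_minus
        evaluates_int_fst_quotient evaluates_int_Lit evaluates_int_of_nat oN t eq sq)+
  have body: "evaluates X sz'
      (Fork (op Plus (op Times (Seq Right Left) ?pd) (op Times (Seq Right Right) ?pe))
        (op Times (Seq Right Right) ?pd)) F
      (\<lambda>x. Node (Atom (fst (part (fst x) (Suc (snd x))))) (Atom (snd (part (fst x) (Suc (snd x))))))"
  proof (rule evaluates_cong)
    show "evaluates X sz'
      (Fork (op Plus (op Times (Seq Right Left) ?pd) (op Times (Seq Right Right) ?pe))
        (op Times (Seq Right Right) ?pd)) F
      (\<lambda>x. Node (Atom (fst (part (fst x) (snd x)) * ?d x + snd (part (fst x) (snd x)) * ?e x))
         (Atom (snd (part (fst x) (snd x)) * ?d x)))"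
      by (intro evaluates_Fork evaluates_int_imp evaluates_int_plus evaluates_int_times a b pd pe)
    fix x assume x: "x \<in> X"
    then have less: "snd x < length (d (fst x))" by (auto simp: X_def)
    obtain a b where ab: "part (fst x) (snd x) = (a, b)" by fastforce
    have "part (fst x) (Suc (snd x)) = transform_step k (N (fst x)) (J (fst x)) (v x, q x) (a, b)"
      using less vq(1)[OF x] by (simp add: part_def take_Suc_conv_app_nth flip: ab)
    then show "Node (Atom (fst (part (fst x) (snd x)) * ?d x + snd (part (fst x) (snd x)) * ?e x))
         (Atom (snd (part (fst x) (snd x)) * ?d x)) =
        Node (Atom (fst (part (fst x) (Suc (snd x))))) (Atom (snd (part (fst x) (Suc (snd x)))))"
      by (simp add: ab t_def Let_def)
  qed simp
  have "evaluates I sz (transform_prog k pN pJ pd) E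
      (\<lambda>i. Node (Atom (fst (part i (length (map ?enc (d i)))))) (Atom (snd (part i (length (map ?enc (d i)))))))"
    unfolding transform_prog_def Let_def
  proof (rule evaluates_fold_loop[OF d _ _ length, where
        acc = "\<lambda>i j. Node (Atom (fst (part i j))) (Atom (snd (part i j)))"])
    have "evaluates I sz (Fork (Lit 0) (Lit 1)) E (\<lambda>i. Node (Atom 0) (Atom 1))"
      by (intro evaluates_Fork evaluates_Lit)
    then show "evaluates I sz (Fork (Lit 0) (Lit 1)) E
        (\<lambda>i. Node (Atom (fst (part i 0))) (Atom (snd (part i 0))))" by (simp add: part_def)
  qed (use body in \<open>simp add: X_def sz'_def[abs_def] F_def[abs_def] pt_def\<close>)
  then show "evaluates I sz (transform_prog k pN pJ pd) E
      (\<lambda>i. Node (Atom (fst (transform k (N i) (J i) (d i)))) (Atom (snd (transform k (N i) (J i) (d i)))))"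
    by (simp add: part_def transform_def)
qed

subsection \<open>Rounded logarithms\<close>

text \<open>
  \<open>level N (a, b) j\<close> is the largest \<open>w \<le> j\<close> with \<open>a / b \<le> (1 - 1 / N) ^ w\<close>.
\<close>

primrec level :: "nat \<Rightarrow> int \<times> int \<Rightarrow> nat \<Rightarrow> nat" where
  "level N r 0 = 0"
| "level N r (Suc j) =
     (if snd r * (int N - 1) ^ (level N r j + 1) < fst r * int N ^ (level N r j + 1)
      then level N r j else level N r j + 1)"

lemma level_le: "level N r j \<le> j"
  by (induction j) auto

text \<open>A linear search suffices, since \<open>J\<close> is bounded in value. The accumulator
  holds the level, and once the test holds it stays the same for the remaining rounds.\<close>

definition level_prog :: "prog \<Rightarrow> prog \<Rightarrow> prog \<Rightarrow> prog" where
  "level_prog N r J =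
     for_loop J (Lit 0)
       (Cond (op Less
           (op Times (Seq (outer r) Right) (pow (op Minus (outer N) (Lit 1)) (op Plus Right (Lit 1))))
           (op Times (Seq (outer r) Left) (pow (outer N) (op Plus Right (Lit 1)))))
         Right (op Plus Right (Lit 1)))"

lemma evaluates_level_prog:
  assumes N: "evaluates_nat I sz pN E N" and J: "evaluates_nat I sz pJ E J"
    and r: "evaluates I sz pr E (\<lambda>i. Node (Atom (fst (r i))) (Atom (snd (r i))))"
    and bits: "poly_bounded I sz (\<lambda>i. bits (r i))"
  shows "evaluates_nat I sz (level_prog pN pr pJ) E (\<lambda>i. level (N i) (r i) (J i))"
proof -
  have J': "poly_bounded I sz J" using J unfolding evaluates_nat_def by blast
  define X where "X = (SIGMA i:I. {..<J i})"
  define sz' where "sz' x = sz (fst x)" for x :: "'a \<times> nat"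
  define w where "w x = level (N (fst x)) (r (fst x)) (snd x)" for x
  define F where "F x = Node (Node (E (fst x)) (Atom (int (J (fst x) - snd x)))) (Atom (int (w x)))" for x
  have oN: "evaluates_nat X sz' (outer pN) F (\<lambda>x. N (fst x))"
    unfolding X_def sz'_def F_def by (rule evaluates_nat_outer[OF N])
  have or: "evaluates X sz' (outer pr) F (\<lambda>x. Node (Atom (fst (r (fst x)))) (Atom (snd (r (fst x)))))"
    unfolding X_def sz'_def F_def by (rule evaluates_outer[OF r])
  have bits': "poly_bounded X sz' (\<lambda>x. bits (r (fst x)))"
    unfolding X_def sz'_def by (rule poly_bounded_fst[OF bits])
  have a: "evaluates_int X sz' (Seq (outer pr) Left) F (\<lambda>x. fst (r (fst x)))"
    unfolding evaluates_int_def
    by (intro conjI evaluates_Seq[OF or evaluates_Left] poly_bounded_mono[OF bits'])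
      (simp add: bits_def)
  have b: "evaluates_int X sz' (Seq (outer pr) Right) F (\<lambda>x. snd (r (fst x)))"
    unfolding evaluates_int_def
    by (intro conjI evaluates_Seq[OF or evaluates_Right] poly_bounded_mono[OF bits'])
      (simp add: bits_def)
  have "poly_bounded X sz' (\<lambda>x. J (fst x))"
    unfolding X_def sz'_def by (rule poly_bounded_fst[OF J'])
  then have "poly_bounded X sz' w"
  proof (rule poly_bounded_mono)
    fix x assume "x \<in> X"
    then show "w x \<le> J (fst x)"
      using level_le[of "N (fst x)" "r (fst x)" "snd x"] by (auto simp: w_def X_def)
  qed
  then have w: "evaluates_nat X sz' Right F w" unfolding F_def by (rule evaluates_nat_Right)
  have w1: "evaluates_nat X sz' (op Plus Right (Lit 1)) F (\<lambda>x. w x + 1)"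
    using evaluates_nat_plus[OF w evaluates_nat_Lit[of X sz' 1]] by simp
  have "evaluates X sz' (Cond (op Less
           (op Times (Seq (outer pr) Right) (pow (op Minus (outer pN) (Lit 1)) (op Plus Right (Lit 1))))
           (op Times (Seq (outer pr) Left) (pow (outer pN) (op Plus Right (Lit 1)))))
         Right (op Plus Right (Lit 1))) F
       (\<lambda>x. Atom (if snd (r (fst x)) * (int (N (fst x)) - 1) ^ (w x + 1)
           < fst (r (fst x)) * int (N (fst x)) ^ (w x + 1) then int (w x) else int (w x + 1)))"
    by (intro evaluates_int_imp evaluates_int_Cond evaluates_int_less evaluates_int_times
        evaluates_int_pow evaluates_int_minus evaluates_int_Lit evaluates_int_of_nat oN a b w w1)
  then have body: "evaluates X sz' (Cond (op Less
           (op Times (Seq (outer pr) Right) (pow (op Minus (outer pN) (Lit 1)) (op Plus Right (Lit 1))))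
           (op Times (Seq (outer pr) Left) (pow (outer pN) (op Plus Right (Lit 1)))))
         Right (op Plus Right (Lit 1))) F (\<lambda>x. Atom (int (w (fst x, Suc (snd x)))))"
    by (rule evaluates_cong) (auto simp: w_def)
  have "evaluates I sz (level_prog pN pr pJ) E (\<lambda>i. Atom (int (w (i, J i))))"
    unfolding level_prog_def
  proof (rule evaluates_for_loop[OF J, where acc = "\<lambda>i j. Atom (int (w (i, j)))"])
    show "evaluates I sz (Lit 0) E (\<lambda>i. Atom (int (w (i, 0))))"
      by (simp add: w_def evaluates_Lit)
  qed (use body in \<open>simp add: X_def sz'_def[abs_def] F_def[abs_def]\<close>)
  moreover have "poly_bounded I sz (\<lambda>i. level (N i) (r i) (J i))"
    using J' by (rule poly_bounded_mono) (rule level_le)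
  ultimately show ?thesis unfolding evaluates_nat_def w_def by simp
qed

subsection \<open>Several weights in one, and the objective\<close>

text \<open>The list is a parameter of the construction and not data: the recursion unrolls into a
  fixed program. Values of order \<open>B ^ length\<close> stay polynomial because this length is
  constant.\<close>

primrec horner_prog :: "prog \<Rightarrow> prog list \<Rightarrow> prog" where
  "horner_prog B [] = Lit 0"
| "horner_prog B (p # ps) = op Plus p (op Times B (horner_prog B ps))"

lemma evaluates_horner_prog:
  assumes B: "evaluates_nat I sz pB E B"
    and "\<And>k. k \<in> set ks \<Longrightarrow> evaluates_nat I sz (p k) E (\<lambda>i. w i k)"
  shows "evaluates_nat I sz (horner_prog pB (map p ks)) E (\<lambda>i. horner_sum (w i) (B i) ks)"
  using assms(2)
proof (induction ks)
  case Nil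
  show ?case using evaluates_nat_Lit[of I sz 0 E] by simp
next
  case (Cons k ks)
  then show ?case by (auto intro!: evaluates_nat_plus evaluates_nat_times B)
qed

lemma poly_bounded_power:
  assumes "poly_bounded I sz f"
  shows "poly_bounded I sz (\<lambda>i. f i ^ k)"
  by (induction k) (auto intro: poly_bounded_mult assms)

lemma evaluates_nat_pow:
  assumes "evaluates_nat I sz p E n"
  shows "evaluates_nat I sz (pow p (Lit (int k))) E (\<lambda>i. n i ^ k)"
proof (rule evaluates_nat_of_int)
  show "evaluates_int I sz (pow p (Lit (int k))) E (\<lambda>i. int (n i) ^ k)"
    by (intro evaluates_int_pow evaluates_int_of_nat evaluates_nat_Lit assms)
  show "poly_bounded I sz (\<lambda>i. n i ^ k)"
    using assms unfolding evaluates_nat_def by (auto intro: poly_bounded_power)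
qed simp

text \<open>
  The digits \<open>t\<^sub>0, t\<^sub>1, \<dots>\<close> of \<open>K\<close> in base \<open>B\<close> stand for the powers \<open>(1 - 1 / N) ^ t\<^sub>k\<close>;
  multiplication by \<open>N ^ B\<close> makes the objective an integer.
\<close>

primrec gain :: "int list \<Rightarrow> nat \<Rightarrow> nat \<Rightarrow> nat \<Rightarrow> int" where
  "gain [] N B K = 0"
| "gain (c # cs) N B K =
     c * ((int N - 1) ^ (K mod B) * int N ^ (B - K mod B)) + gain cs N B (K div B)"

primrec gain_prog :: "int list \<Rightarrow> prog \<Rightarrow> prog \<Rightarrow> prog \<Rightarrow> prog" where
  "gain_prog [] N B K = Lit 0"
| "gain_prog (c # cs) N B K =
     op Plus (op Times (Lit c) (op Times (pow (op Minus N (Lit 1)) (remainder K B))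
         (pow N (op Minus B (remainder K B)))))
       (gain_prog cs N B (op Divide K B))"

lemma evaluates_gain_prog:
  assumes N: "evaluates_nat I sz pN E N" and B: "evaluates_nat I sz pB E B"
    and pos: "\<And>i. i \<in> I \<Longrightarrow> 0 < B i" and K: "evaluates_nat I sz pK E K"
  shows "evaluates_int I sz (gain_prog cs pN pB pK) E (\<lambda>i. gain cs (N i) (B i) (K i))"
  using K
proof (induction cs arbitrary: pK K)
  case Nil
  show ?case by (simp add: evaluates_int_Lit)
next
  case (Cons c cs)
  \<comment> \<open>Natural subtraction agrees with the subtraction of the machine only in this
    range; for \<open>B i = 0\<close> the remainder would be \<open>K i\<close> itself.\<close>
  have "K i mod B i \<le> B i" if "i \<in> I" for i
    using pos[OF that] by (simp add: less_imp_le)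
  then show ?case
    unfolding gain.simps gain_prog.simps
    by (intro evaluates_int_plus evaluates_int_times evaluates_int_pow evaluates_int_minus
        evaluates_int_Lit evaluates_int_of_nat[OF N] evaluates_nat_remainder evaluates_nat_minus
        evaluates_nat_div N B Cons)
qed

subsection \<open>Maximization over a range\<close>

text \<open>The candidates come in the order \<open>M - 1, ..., 0\<close> because loop variables
  count down from \<open>M\<close> to \<open>1\<close>; the search starts with \<open>0\<close> as
  the provisional best.\<close>

primrec argmax :: "(nat \<Rightarrow> int) \<Rightarrow> nat \<Rightarrow> nat \<Rightarrow> nat" where
  "argmax f M 0 = 0"
| "argmax f M (Suc j) = (if f (argmax f M j) < f (M - j - 1) then M - j - 1 else argmax f M j)"

lemma argmax_less: "0 < M \<Longrightarrow> argmax f M j < M"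
  by (induction j) auto

text \<open>After \<open>j\<close> rounds the candidates from \<open>M - j\<close> upwards have been
  tested, and the score of the provisional best never decreases.\<close>

lemma argmax_ge_partial:
  assumes "M - j \<le> K" and "K < M" and "j \<le> M"
  shows "f K \<le> f (argmax f M j)"
  using assms
proof (induction j)
  case (Suc j)
  show ?case
  proof (cases "K = M - j - 1")
    case False
    then have "f K \<le> f (argmax f M j)" using Suc by simp
    then show ?thesis by auto
  qed simp
qed simp

lemma argmax_ge: "K < M \<Longrightarrow> f K \<le> f (argmax f M M)"
  using argmax_ge_partial[of M M K f] by simp

definition argmax_prog :: "prog \<Rightarrow> (prog \<Rightarrow> prog) \<Rightarrow> prog" where
  "argmax_prog M f = for_loop M (Lit 0)
     (Cond (op Less (f Right) (f (op Minus loop_var (Lit 1)))) (op Minus loop_var (Lit 1)) Right)"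

text \<open>The body contains the score program twice, at the provisional best and at the new
  candidate; hence the hypothesis for every argument program \<open>pK\<close>. The trees
  \<open>u\<close> and \<open>w\<close> stand for the loop variable and the accumulator.\<close>

lemma evaluates_argmax_prog:
  assumes M: "evaluates_nat I sz pM E M"
    and f: "\<And>u w pK K. evaluates_nat (SIGMA i:I. {..<M i}) (\<lambda>x. sz (fst x)) pK
          (\<lambda>x. Node (Node (E (fst x)) (u x)) (w x)) K \<Longrightarrow>
        evaluates_int (SIGMA i:I. {..<M i}) (\<lambda>x. sz (fst x)) (f pK)
          (\<lambda>x. Node (Node (E (fst x)) (u x)) (w x)) (\<lambda>x. score (fst x) (K x))"
  shows "evaluates_nat I sz (argmax_prog pM f) E (\<lambda>i. argmax (score i) (M i) (M i))"
proof -
  have M': "poly_bounded I sz M" using M unfolding evaluates_nat_def by blast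
  define X where "X = (SIGMA i:I. {..<M i})"
  define sz' where "sz' x = sz (fst x)" for x :: "'a \<times> nat"
  define b where "b x = argmax (score (fst x)) (M (fst x)) (snd x)" for x
  define F where "F x = Node (Node (E (fst x)) (Atom (int (M (fst x) - snd x)))) (Atom (int (b x)))" for x
  have MX: "poly_bounded X sz' (\<lambda>x. M (fst x))"
    unfolding X_def sz'_def by (rule poly_bounded_fst[OF M'])
  have f': "evaluates_int X sz' (f pK) F (\<lambda>x. score (fst x) (K x))"
    if "evaluates_nat X sz' pK F K" for pK K
    using that unfolding X_def sz'_def[abs_def] F_def[abs_def] by (rule f)
  have "poly_bounded X sz' b"
    using MX by (rule poly_bounded_mono) (auto simp: b_def X_def intro!: less_imp_le argmax_less)
  then have b: "evaluates_nat X sz' Right F b" unfolding F_def by (rule evaluates_nat_Right)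
  have "poly_bounded X sz' (\<lambda>x. M (fst x) - snd x)"
    using MX by (rule poly_bounded_mono) simp
  moreover have "evaluates X sz' loop_var F (\<lambda>x. Atom (int (M (fst x) - snd x)))"
    unfolding F_def by (rule evaluates_Seq[OF evaluates_Left evaluates_Right])
  ultimately have "evaluates_nat X sz' loop_var F (\<lambda>x. M (fst x) - snd x)"
    unfolding evaluates_nat_def by blast
  moreover have "evaluates_nat X sz' (Lit 1) F (\<lambda>_. 1)"
    using evaluates_nat_Lit[of X sz' 1 F] by simp
  ultimately have K: "evaluates_nat X sz' (op Minus loop_var (Lit 1)) F (\<lambda>x. M (fst x) - snd x - 1)"
    by (rule evaluates_nat_minus) (auto simp: X_def)
  have "evaluates X sz' (Cond (op Less (f Right) (f (op Minus loop_var (Lit 1))))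
      (op Minus loop_var (Lit 1)) Right) F
      (\<lambda>x. Atom (if score (fst x) (b x) < score (fst x) (M (fst x) - snd x - 1)
        then int (M (fst x) - snd x - 1) else int (b x)))"
    by (intro evaluates_int_imp evaluates_int_Cond evaluates_int_less f' evaluates_int_of_nat K b)
  then have body: "evaluates X sz' (Cond (op Less (f Right) (f (op Minus loop_var (Lit 1))))
      (op Minus loop_var (Lit 1)) Right) F (\<lambda>x. Atom (int (b (fst x, Suc (snd x)))))"
    by (rule evaluates_cong) (auto simp: b_def)
  have "evaluates I sz (argmax_prog pM f) E (\<lambda>i. Atom (int (b (i, M i))))"
    unfolding argmax_prog_def
  proof (rule evaluates_for_loop[OF M, where acc = "\<lambda>i j. Atom (int (b (i, j)))"])
    show "evaluates I sz (Lit 0) E (\<lambda>i. Atom (int (b (i, 0))))"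
      by (simp add: b_def evaluates_Lit)
  qed (use body in \<open>simp add: X_def sz'_def[abs_def] F_def[abs_def]\<close>)
  moreover have "poly_bounded I sz (\<lambda>i. argmax (score i) (M i) (M i))"
  proof (rule poly_bounded_mono)
    show "argmax (score i) (M i) (M i) \<le> M i" for i
      using argmax_less[of "M i" "score i" "M i"] by (cases "M i") auto
  qed (rule M')
  ultimately show ?thesis unfolding evaluates_nat_def b_def by simp
qed

subsection \<open>Calling the algorithm for the exact problem\<close>

text \<open>The exact problem may have many correct answers. As programs are deterministic, the one
  that \<open>p\<close> returns is a function of the input, and this choice names it.\<close>

definition exact_answer :: "problem \<Rightarrow> prog \<Rightarrow> data \<Rightarrow> int list \<Rightarrow> nat \<Rightarrow> data" where
  "exact_answer A p x w K =
     (SOME v. v \<in> exact_answers A x w (int K) \<and> (\<exists>t. run p (exact_input x w (int K)) v t))"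

lemma exact_answer:
  assumes "pseudopolynomial_exact A p"
  obtains P :: "nat poly" where
    "\<And>x (w :: int list) K. x \<in> instances A \<Longrightarrow> length w = ground_size A x \<Longrightarrow> (\<forall>c\<in>set w. 0 \<le> c) \<Longrightarrow>
       exact_answer A p x w K \<in> exact_answers A x w (int K) \<and>
       (\<exists>t \<le> poly P (data_size (exact_input x w (int K)) + K).
          run p (exact_input x w (int K)) (exact_answer A p x w K) t)"
proof -
  obtain P :: "nat poly" where P: "\<forall>x \<in> instances A. \<forall>w K.
        length w = ground_size A x \<and> (\<forall>c \<in> set w. 0 \<le> c) \<and> 0 \<le> K \<longrightarrow>
        outputs_within p (exact_input x w K)
          (poly P (data_size (exact_input x w K) + nat K)) (exact_answers A x w K)"
    using assms unfolding pseudopolynomial_exact_def by blast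
  show thesis
  proof (rule that)
    fix x K and w :: "int list"
    assume "x \<in> instances A" "length w = ground_size A x" "\<forall>c\<in>set w. 0 \<le> c"
    then have "outputs_within p (exact_input x w (int K))
        (poly P (data_size (exact_input x w (int K)) + K)) (exact_answers A x w (int K))"
      using P[rule_format, of x w "int K"] by simp
    then obtain v t where v: "run p (exact_input x w (int K)) v t"
      "t \<le> poly P (data_size (exact_input x w (int K)) + K)" "v \<in> exact_answers A x w (int K)"
      unfolding outputs_within_def by blast
    have "exact_answer A p x w K \<in> exact_answers A x w (int K) \<and>
        (\<exists>t. run p (exact_input x w (int K)) (exact_answer A p x w K) t)"
      unfolding exact_answer_def by (rule someI[of _ v]) (use v in blast)
    \<comment> \<open>The chosen answer is the result of the run whose time is bounded, so that the
      bound applies to it.\<close>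
    moreover from this have "exact_answer A p x w K = v"
      using run_deterministic v(1) by blast
    ultimately show "exact_answer A p x w K \<in> exact_answers A x w (int K) \<and>
       (\<exists>t \<le> poly P (data_size (exact_input x w (int K)) + K).
          run p (exact_input x w (int K)) (exact_answer A p x w K) t)"
      using v by blast
  qed
qed

text \<open>Here pseudopolynomial becomes polynomial: the target \<open>K\<close> is bounded in
  value, not only in length.\<close>

lemma evaluates_exact:
  assumes p: "pseudopolynomial_exact A p"
    and inst: "\<And>i. i \<in> I \<Longrightarrow> x i \<in> instances A \<and> length (w i) = ground_size A (x i) \<and> (\<forall>c\<in>set (w i). 0 \<le> c)"
    and size: "poly_bounded I sz (\<lambda>i. data_size (Node (x i) (enc_list (map Atom (w i)))))"
    and K: "poly_bounded I sz K"
  shows "evaluates I sz p (\<lambda>i. exact_input (x i) (w i) (int (K i)))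
    (\<lambda>i. exact_answer A p (x i) (w i) (K i))"
proof -
  obtain P :: "nat poly" where P: "\<And>x (w :: int list) K. x \<in> instances A \<Longrightarrow> length w = ground_size A x \<Longrightarrow>
       (\<forall>c\<in>set w. 0 \<le> c) \<Longrightarrow>
       (\<exists>t \<le> poly P (data_size (exact_input x w (int K)) + K).
          run p (exact_input x w (int K)) (exact_answer A p x w K) t)"
    using exact_answer[OF p] by metis
  then have "\<forall>i\<in>I. \<exists>t \<le> poly P (data_size (exact_input (x i) (w i) (int (K i))) + K i).
      run p (exact_input (x i) (w i) (int (K i))) (exact_answer A p (x i) (w i) (K i)) t"
    using inst by blast
  then obtain t where t: "\<And>i. i \<in> I \<Longrightarrow> t i \<le> poly P (data_size (exact_input (x i) (w i) (int (K i))) + K i)"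
    "\<And>i. i \<in> I \<Longrightarrow> run p (exact_input (x i) (w i) (int (K i))) (exact_answer A p (x i) (w i) (K i)) (t i)"
    by metis
  have "poly_bounded I sz (\<lambda>i. data_size (exact_input (x i) (w i) (int (K i))))"
  proof (rule poly_bounded_mono)
    show "poly_bounded I sz (\<lambda>i. data_size (Node (x i) (enc_list (map Atom (w i)))) + (2 + K i))"
      by (intro poly_bounded_add poly_bounded_const size K)
    show "data_size (exact_input (x i) (w i) (int (K i)))
        \<le> data_size (Node (x i) (enc_list (map Atom (w i)))) + (2 + K i)" for i
      using bit_length_int_le[of "K i"] by (simp add: exact_input_def)
  qed
  then have "poly_bounded I sz (\<lambda>i. poly P (data_size (exact_input (x i) (w i) (int (K i))) + K i))"
    by (intro poly_bounded_poly poly_bounded_add K)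
  then have "poly_bounded I sz t" by (rule poly_bounded_mono) (rule t)
  then show ?thesis using t(2) unfolding evaluates_def by blast
qed

section \<open>Error estimates\<close>

subsection \<open>Approximating the utility by exponentials\<close>

lemma exponential_approximation:
  fixes \<mu> :: "real \<Rightarrow> real"
  assumes cont: "continuous_on {0..} \<mu>" and lim: "(\<mu> \<longlongrightarrow> 0) at_top" and "0 < e"
  obtains cs :: "int list" and D :: nat where "0 < D"
    and "\<And>x. 0 \<le> x \<Longrightarrow> \<bar>\<mu> x - (\<Sum>k<length cs. of_int (cs ! k) / D * exp (- x) ^ k)\<bar> \<le> e"
proof -
  define f where "f y = (if y = 0 then 0 else \<mu> (- ln y))" for y
  have "continuous_on {0..1} f"
    unfolding continuous_on_eq_continuous_within
  proof
    fix y :: real assume y: "y \<in> {0..1}"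
    show "continuous (at y within {0..1}) f"
    proof (cases "y = 0")
      case True
      have "filterlim (\<lambda>y :: real. - ln y) at_top (at_right 0)"
        using ln_at_0 by (simp add: filterlim_uminus_at_top)
      then have "((\<lambda>y. \<mu> (- ln y)) \<longlongrightarrow> 0) (at_right 0)"
        by (rule filterlim_compose[OF lim])
      moreover have "\<forall>\<^sub>F y :: real in at_right 0. \<mu> (- ln y) = f y"
        unfolding eventually_at_right_field by (auto simp: f_def intro: exI[of _ 1])
      ultimately have "(f \<longlongrightarrow> 0) (at_right 0)"
        by (rule Lim_transform_eventually)
      then have "(f \<longlongrightarrow> 0) (at 0 within {0..1})"
        by (simp add: at_within_Icc_at_right)
      then show ?thesis by (simp add: True continuous_within f_def)
    next
      case False
      have "continuous_on {0<..1} (\<lambda>y. \<mu> (- ln y))"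
        by (rule continuous_on_compose2[OF cont]) (auto intro!: continuous_intros)
      then have "continuous_on {0<..1} f"
        by (rule continuous_on_eq) (auto simp: f_def)
      then have "continuous (at y within {0<..1}) f"
        using y False by (auto simp: continuous_on_eq_continuous_within)
      \<comment> \<open>Near a point \<open>y > 0\<close> the missing endpoint \<open>0\<close> is
        invisible.\<close>
      moreover have "at y within {0<..1} = at y within {0..1}"
        by (rule at_within_nhd[of _ "{0<..}"]) (use y False in auto)
      ultimately show ?thesis by (simp add: continuous_within)
    qed
  qed
  then obtain g where g: "real_polynomial_function g" "\<And>y. y \<in> {0..1} \<Longrightarrow> \<bar>f y - g y\<bar> < e / 2"
    using Stone_Weierstrass_real_polynomial_function[of "{0..1}" f "e / 2"] \<open>0 < e\<close> by auto
  then obtain a n where a: "g = (\<lambda>y. \<Sum>k\<le>n. a k * y ^ k)"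
    unfolding real_polynomial_function_iff_sum by blast
  \<comment> \<open>The program can contain only integers, so the \<open>n + 1\<close> coefficients
    are rounded down to multiples of \<open>1 / D\<close>. Each costs at most \<open>1 / D\<close>,
    as the powers of \<open>exp (- x)\<close> are at most \<open>1\<close>; the choice of
    \<open>D\<close> makes the total at most \<open>e / 2\<close>.\<close>
  obtain D :: nat where D: "real (Suc n) / (e / 2) < D" using reals_Archimedean2 by blast
  moreover have "0 < real (Suc n) / (e / 2)" using \<open>0 < e\<close> by simp
  ultimately have "0 < D" using of_nat_0_less_iff by (metis order_less_trans)
  define cs where "cs = map (\<lambda>k. \<lfloor>a k * D\<rfloor>) [0..<Suc n]"
  show thesis
  proof (rule that[of D cs])
    show "0 < D" by fact
    fix x :: real assume x: "0 \<le> x"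
    let ?y = "exp (- x)"
    have y: "0 < ?y" "?y \<le> 1" using x by auto
    have "\<bar>a k * ?y ^ k - of_int \<lfloor>a k * D\<rfloor> / D * ?y ^ k\<bar> \<le> 1 / D" for k
    proof -
      have "\<bar>a k * D - of_int \<lfloor>a k * D\<rfloor>\<bar> \<le> 1" by linarith
      then have "\<bar>a k * D - of_int \<lfloor>a k * D\<rfloor>\<bar> / D \<le> 1 / D"
        by (intro divide_right_mono) auto
      moreover have "\<bar>a k * D - of_int \<lfloor>a k * D\<rfloor>\<bar> / D = \<bar>a k - of_int \<lfloor>a k * D\<rfloor> / D\<bar>"
        using \<open>0 < D\<close> by (simp add: field_simps flip: abs_divide)
      ultimately have "\<bar>a k - of_int \<lfloor>a k * D\<rfloor> / D\<bar> \<le> 1 / D" by simp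
      moreover have "?y ^ k \<le> 1" using y by (intro power_le_one) auto
      ultimately have "\<bar>a k - of_int \<lfloor>a k * D\<rfloor> / D\<bar> * ?y ^ k \<le> 1 / D * 1"
        by (intro mult_mono) auto
      moreover have "a k * ?y ^ k - of_int \<lfloor>a k * D\<rfloor> / D * ?y ^ k =
          (a k - of_int \<lfloor>a k * D\<rfloor> / D) * ?y ^ k" by (simp add: algebra_simps)
      ultimately show ?thesis by (simp add: abs_mult)
    qed
    then have "\<bar>\<Sum>k<Suc n. a k * ?y ^ k - of_int \<lfloor>a k * D\<rfloor> / D * ?y ^ k\<bar> \<le> (\<Sum>k<Suc n. 1 / D)"
      by (intro order_trans[OF sum_abs] sum_mono)
    also have "\<dots> \<le> e / 2" using D \<open>0 < D\<close> \<open>0 < e\<close> by (simp add: field_simps)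
    finally have "\<bar>g ?y - (\<Sum>k<Suc n. of_int \<lfloor>a k * D\<rfloor> / D * ?y ^ k)\<bar> \<le> e / 2"
      by (simp add: a sum_subtractf lessThan_Suc_atMost del: sum.lessThan_Suc)
    moreover have "(\<Sum>k<length cs. of_int (cs ! k) / D * ?y ^ k) =
        (\<Sum>k<Suc n. of_int \<lfloor>a k * D\<rfloor> / D * ?y ^ k)"
      unfolding cs_def by (intro sum.cong) (auto simp del: upt_Suc)
    moreover have "\<bar>\<mu> x - g ?y\<bar> < e / 2" using g(2)[of ?y] y by (simp add: f_def)
    ultimately show "\<bar>\<mu> x - (\<Sum>k<length cs. of_int (cs ! k) / D * ?y ^ k)\<bar> \<le> e" by linarith
  qed
qed

text \<open>The source of the factor \<open>k\<close> in the error terms, obtained by telescoping: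
  the derivative of \<open>y ^ k\<close> is at most \<open>k\<close> on the unit interval.\<close>

lemma abs_power_diff_le:
  fixes y z :: real
  assumes "0 \<le> y" "y \<le> 1" "0 \<le> z" "z \<le> 1"
  shows "\<bar>y ^ k - z ^ k\<bar> \<le> k * \<bar>y - z\<bar>"
proof (induction k)
  case (Suc k)
  have "\<bar>y ^ Suc k - z ^ Suc k\<bar> = \<bar>y * (y ^ k - z ^ k) + (y - z) * z ^ k\<bar>"
    by (simp add: algebra_simps)
  also have "\<dots> \<le> \<bar>y\<bar> * \<bar>y ^ k - z ^ k\<bar> + \<bar>y - z\<bar> * \<bar>z ^ k\<bar>"
    by (metis abs_mult abs_triangle_ineq)
  also have "\<dots> \<le> 1 * (k * \<bar>y - z\<bar>) + \<bar>y - z\<bar> * 1"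
    using Suc assms by (intro add_mono mult_mono) (auto simp: power_le_one)
  finally show ?case by (simp add: algebra_simps)
qed simp

subsection \<open>Discretization of the weights\<close>

text \<open>This is \<open>1 - h \<le> exp (- h)\<close> for \<open>h = x - u\<close>, multiplied by
  \<open>exp (- u)\<close>. Keeping that factor lets \<open>exp_minus_power_le\<close> absorb a
  factor \<open>u\<close> and become uniform in \<open>i\<close>.\<close>

lemma exp_minus_diff_le:
  fixes u x :: real
  assumes "0 \<le> u" "u \<le> x"
  shows "exp (- u) - exp (- x) \<le> exp (- u) * (x - u)"
proof -
  have "exp (- x) = exp (- u) * exp (- (x - u))" by (simp flip: exp_add)
  moreover have "1 - (x - u) \<le> exp (- (x - u))" using exp_ge_add_one_self[of "u - x"] by (simp add: algebra_simps)
  ultimately have "exp (- u) * (1 - (x - u)) \<le> exp (- x)" by simp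
  then show ?thesis by (simp add: algebra_simps)
qed

lemma power_le_exp:
  assumes "0 < N"
  shows "(1 - 1 / real N) ^ i \<le> exp (- (i / N))"
proof -
  have "(1 - 1 / real N) ^ i \<le> exp (- (1 / N)) ^ i"
    using exp_ge_add_one_self[of "- (1 / real N)"] assms by (intro power_mono) (auto simp: field_simps)
  also have "\<dots> = exp (- (i / N))" by (simp flip: exp_of_nat_mult)
  finally show ?thesis .
qed

lemma exp_minus_le_inverse:
  fixes h :: real
  assumes "0 < h"
  shows "exp (- h) \<le> 1 / h"
proof -
  have "h \<le> exp h" using exp_ge_add_one_self[of h] by linarith
  then show ?thesis using assms by (simp add: exp_minus field_simps)
qed

text \<open>Since \<open>1 - 1 / N = 1 / (1 + 1 / (N - 1)) \<ge> exp (- 1 / (N - 1))\<close>, the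
  power is at least \<open>exp (- i / (N - 1))\<close>. This exponent exceeds
  \<open>u = i / N\<close> by \<open>u / (N - 1)\<close>, and \<open>u * exp (- u) \<le> 1\<close>
  removes the dependence on \<open>i\<close>.\<close>

lemma exp_minus_power_le:
  assumes "2 \<le> N"
  shows "exp (- (i / real N)) - (1 - 1 / real N) ^ i \<le> 1 / (real N - 1)"
proof -
  define u where "u = i / real N"
  have N: "2 \<le> real N" using assms by simp
  have "exp (- (1 / (real N - 1))) \<le> 1 - 1 / real N"
  proof -
    have "1 + 1 / (real N - 1) \<le> exp (1 / (real N - 1))" by (rule exp_ge_add_one_self)
    moreover have "1 + 1 / (real N - 1) = 1 / (1 - 1 / real N)" using N by (simp add: field_simps)
    ultimately have "1 / exp (1 / (real N - 1)) \<le> 1 / (1 / (1 - 1 / real N))"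
      using N by (intro divide_left_mono) auto
    then show ?thesis by (simp add: exp_minus inverse_eq_divide)
  qed
  then have "exp (- (1 / (real N - 1))) ^ i \<le> (1 - 1 / real N) ^ i" by (intro power_mono) auto
  then have lower: "exp (- (i / (real N - 1))) \<le> (1 - 1 / real N) ^ i"
    by (simp flip: exp_of_nat_mult)
  have u: "0 \<le> u" "i / (real N - 1) - u = u / (real N - 1)"
    using N by (auto simp: u_def field_simps)
  have "exp (- u) - exp (- (i / (real N - 1))) \<le> exp (- u) * (u / (real N - 1))"
  proof -
    have "0 \<le> u / (real N - 1)" using u N by simp
    then have "u \<le> i / (real N - 1)" using u by linarith
    from exp_minus_diff_le[OF u(1) this] show ?thesis by (simp only: u(2))
  qed
  also have "\<dots> \<le> 1 / (real N - 1)"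
  proof -
    have "u \<le> exp u" using exp_ge_add_one_self[of u] by linarith
    then have "exp (- u) * u \<le> 1" by (simp add: exp_minus field_simps)
    then show ?thesis using N by (simp add: divide_right_mono)
  qed
  finally show ?thesis using lower by (simp add: u_def)
qed

text \<open>If some weight reaches the cap, both quantities lie between \<open>0\<close> and
  \<open>exp (- H)\<close>. Otherwise the two errors have opposite signs and do not add up: rounding
  down raises the value, by at most \<open>n / N\<close>, and the base \<open>1 - 1 / N\<close>
  lowers it, by at most \<open>1 / (N - 1)\<close>.\<close>

lemma grid_error:
  fixes X :: "nat \<Rightarrow> real" and H n N J :: nat
  assumes S: "finite S" "card S \<le> n" and X: "\<And>b. b \<in> S \<Longrightarrow> 0 \<le> X b" and H: "0 < H"
    and N: "N = H * (n + 2)" and J: "J = H * N"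
  shows "\<bar>(1 - 1 / N) ^ (\<Sum>b\<in>S. grid N J (X b)) - exp (- (\<Sum>b\<in>S. X b))\<bar> \<le> 1 / H"
proof -
  define i where "i = (\<Sum>b\<in>S. grid N J (X b))"
  define x where "x = (\<Sum>b\<in>S. X b)"
  \<comment> \<open>The summand \<open>2\<close> in \<open>n + 2\<close> ensures both inequalities
    even for \<open>n = 0\<close>.\<close>
  have N2: "2 \<le> N" "H \<le> N - 1"
    using H by (auto simp: N algebra_simps)
  then have "0 < N" by simp
  have x: "0 \<le> x" unfolding x_def by (intro sum_nonneg X)
  have upper: "(1 - 1 / real N) ^ i \<le> exp (- (i / N))" using \<open>0 < N\<close> by (rule power_le_exp)
  have nonneg: "0 \<le> (1 - 1 / real N) ^ i" using N2 by simp
  have "\<bar>(1 - 1 / real N) ^ i - exp (- x)\<bar> \<le> 1 / H"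
  proof (cases "\<exists>b\<in>S. real J \<le> X b * N")
    case True
    then obtain b where b: "b \<in> S" "real J \<le> X b * N" by blast
    then have "grid N J (X b) = J" by (simp add: grid_def min_def) linarith
    then have "J \<le> i" using member_le_sum[of b S "\<lambda>b. grid N J (X b)"] b S by (simp add: i_def)
    then have "real H \<le> i / N" using \<open>0 < N\<close> by (simp add: J field_simps flip: of_nat_mult)
    then have "exp (- (i / N)) \<le> exp (- real H)" by simp
    moreover have "real H \<le> X b" using b \<open>0 < N\<close> by (simp add: J)
    then have "real H \<le> x" using member_le_sum[of b S X] b S X by (simp add: x_def)
    then have "exp (- x) \<le> exp (- real H)" by simp
    moreover have "exp (- real H) \<le> 1 / H" using H by (intro exp_minus_le_inverse) simp
    moreover have "0 < exp (- x)" by simp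
    ultimately show ?thesis using upper nonneg by linarith
  next
    case False
    have grid: "X b * N - 1 \<le> grid N J (X b) \<and> grid N J (X b) \<le> X b * N" if "b \<in> S" for b
    proof -
      have "0 \<le> X b * N" "X b * N < J" using False that X[of b] by auto
      then have "grid N J (X b) = nat \<lfloor>X b * N\<rfloor>" unfolding grid_def by linarith
      then show ?thesis using \<open>0 \<le> X b * N\<close> by linarith
    qed
    have "real i \<le> (\<Sum>b\<in>S. X b * N)" unfolding i_def of_nat_sum by (intro sum_mono) (use grid in auto)
    then have "real i \<le> x * N" by (simp add: x_def sum_distrib_right)
    then have ix: "i / N \<le> x" using \<open>0 < N\<close> by (simp add: field_simps)
    have "(\<Sum>b\<in>S. X b * N - 1) \<le> real i" unfolding i_def of_nat_sum by (intro sum_mono) (use grid in auto)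
    then have "x * N - card S \<le> i" by (simp add: x_def sum_subtractf sum_distrib_right)
    then have "x * N - n \<le> i" using S by linarith
    then have "x \<le> (i + n) / N" using \<open>0 < N\<close> by (simp add: field_simps)
    then have "x - i / N \<le> n / N" by (simp add: add_divide_distrib)
    moreover have "n / N \<le> 1 / H"
    proof -
      have "n * H \<le> N" by (simp add: N)
      then have "real n * real H \<le> N" by (simp flip: of_nat_mult)
      then show ?thesis using H \<open>0 < N\<close> by (simp add: field_simps)
    qed
    moreover have "exp (- (i / N)) - exp (- x) \<le> x - i / N"
    proof -
      have "exp (- (i / N)) - exp (- x) \<le> exp (- (i / N)) * (x - i / N)"
        using ix by (intro exp_minus_diff_le) auto
      also have "\<dots> \<le> 1 * (x - i / N)" using ix by (intro mult_right_mono) auto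
      finally show ?thesis by simp
    qed
    ultimately have "(1 - 1 / real N) ^ i - exp (- x) \<le> 1 / H" using upper by linarith
    moreover have "exp (- x) - (1 - 1 / real N) ^ i \<le> 1 / H"
    proof -
      have "1 / (real N - 1) \<le> 1 / H" using N2 H by (intro divide_left_mono) auto
      moreover have "exp (- x) \<le> exp (- (i / N))" using ix by simp
      ultimately show ?thesis using exp_minus_power_le[OF N2(1), of i] by linarith
    qed
    ultimately show ?thesis by linarith
  qed
  then show ?thesis by (simp add: i_def x_def)
qed

subsection \<open>Rounding of the logarithms\<close>

text \<open>The hypothesis \<open>a \<le> b\<close> starts the invariant at level \<open>0\<close>.
  Either all tests so far have raised the level, or it is stuck at a value whose successor fails,
  and then it remains there.\<close>

lemma level_approximates:
  fixes a b :: int and N :: nat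
  assumes "0 < N" "0 < b" "a \<le> b"
  defines "\<rho> \<equiv> 1 - 1 / real N" and "w \<equiv> level N (a, b)"
  shows "a / b \<le> \<rho> ^ w j" and "w j = j \<or> \<rho> ^ Suc (w j) < a / b"
proof -
  \<comment> \<open>The integer test of \<open>level\<close> is the comparison of fractions with the
    positive denominators multiplied out.\<close>
  have iff: "b * (int N - 1) ^ m < a * int N ^ m \<longleftrightarrow> \<rho> ^ m < a / b" for m
  proof -
    have "b * (int N - 1) ^ m < a * int N ^ m \<longleftrightarrow>
        real_of_int (b * (int N - 1) ^ m) < real_of_int (a * int N ^ m)"
      by (simp only: of_int_less_iff)
    also have "\<dots> \<longleftrightarrow> ((real N - 1) / N) ^ m < a / b"
      using assms by (simp add: power_divide field_simps)
    also have "(real N - 1) / N = \<rho>" using assms by (simp add: field_simps)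
    finally show ?thesis .
  qed
  have "a / b \<le> \<rho> ^ w j \<and> (w j = j \<or> \<rho> ^ Suc (w j) < a / b)"
  proof (induction j)
    case 0
    show ?case using assms by (simp add: w_def)
  next
    case (Suc j)
    have "w (Suc j) = (if \<rho> ^ Suc (w j) < a / b then w j else Suc (w j))"
      using iff[of "Suc (w j)"] by (simp add: w_def)
    then show ?case using Suc by auto
  qed
  then show "a / b \<le> \<rho> ^ w j" "w j = j \<or> \<rho> ^ Suc (w j) < a / b" by auto
qed

text \<open>If some exponent is capped, both products are at most \<open>\<delta>\<close>. Otherwise
  each factor is off by less than one power of \<open>\<rho>\<close>, and Bernoulli bounds the loss
  \<open>1 - \<rho> ^ card S\<close> by \<open>n * (1 - \<rho>)\<close>.\<close>

lemma product_error:
  fixes \<rho> \<delta> :: real and e :: "nat \<Rightarrow> real" and w :: "nat \<Rightarrow> nat"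
  assumes S: "finite S" "card S \<le> n" and \<rho>: "0 \<le> \<rho>" "\<rho> \<le> 1"
    and e: "\<And>b. b \<in> S \<Longrightarrow> 0 \<le> e b \<and> e b \<le> \<rho> ^ w b"
    and w: "\<And>b. b \<in> S \<Longrightarrow> w b = J \<or> \<rho> ^ Suc (w b) < e b"
    and J: "\<rho> ^ J \<le> \<delta>" and n: "n * (1 - \<rho>) \<le> \<delta>"
  shows "\<bar>(\<Prod>b\<in>S. e b) - \<rho> ^ (\<Sum>b\<in>S. w b)\<bar> \<le> \<delta>"
proof -
  have upper: "(\<Prod>b\<in>S. e b) \<le> \<rho> ^ (\<Sum>b\<in>S. w b)"
    unfolding power_sum by (intro prod_mono e)
  have nonneg: "0 \<le> (\<Prod>b\<in>S. e b)" using e by (intro prod_nonneg) auto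
  have "\<rho> ^ (\<Sum>b\<in>S. w b) - (\<Prod>b\<in>S. e b) \<le> \<delta>"
  proof (cases "\<exists>b\<in>S. w b = J")
    case True
    then have "J \<le> (\<Sum>b\<in>S. w b)" using S by (auto intro: member_le_sum)
    then have "\<rho> ^ (\<Sum>b\<in>S. w b) \<le> \<rho> ^ J" using \<rho> by (intro power_decreasing)
    then show ?thesis using J nonneg by linarith
  next
    case False
    have "(\<Prod>b\<in>S. \<rho> ^ Suc (w b)) \<le> (\<Prod>b\<in>S. e b)"
      using w False \<rho> by (intro prod_mono) (auto simp: less_imp_le)
    moreover have "(\<Prod>b\<in>S. \<rho> ^ Suc (w b)) = \<rho> ^ (\<Sum>b\<in>S. w b) * \<rho> ^ card S"
      by (simp add: prod.distrib power_sum mult.commute)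
    moreover have "1 - \<delta> \<le> \<rho> ^ card S"
    proof -
      have "1 + real (card S) * (\<rho> - 1) \<le> (1 + (\<rho> - 1)) ^ card S"
        using \<rho> by (intro Bernoulli_inequality) auto
      moreover have "real (card S) * (1 - \<rho>) \<le> n * (1 - \<rho>)"
        using S \<rho> by (intro mult_right_mono) auto
      ultimately show ?thesis using n by (simp add: algebra_simps)
    qed
    then have "\<rho> ^ (\<Sum>b\<in>S. w b) * (1 - \<delta>) \<le> \<rho> ^ (\<Sum>b\<in>S. w b) * \<rho> ^ card S"
      using \<rho> by (intro mult_left_mono) auto
    moreover have "\<rho> ^ (\<Sum>b\<in>S. w b) * \<delta> \<le> 1 * \<delta>"
    proof (intro mult_right_mono power_le_one \<rho>)
      show "0 \<le> \<delta>" using J \<rho> zero_le_power order_trans by metis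
    qed
    ultimately show ?thesis by (simp add: algebra_simps)
  qed
  then show ?thesis using upper by linarith
qed

subsection \<open>Expectations\<close>

text \<open>An arbitrary initial fraction makes the induction work; positivity of the denominator is
  carried along to justify the division.\<close>

lemma transform_fold:
  fixes N k J :: nat and r :: "int \<times> int" and d :: distribution
  assumes N: "0 < N" and "0 < snd r"
  defines "\<rho> \<equiv> 1 - 1 / real N" and "r' \<equiv> fold (transform_step k N J) d r"
  shows "0 < snd r' \<and> real_of_int (fst r') / real_of_int (snd r') =
    real_of_int (fst r) / real_of_int (snd r) + (\<Sum>(v, q)\<leftarrow>d. of_rat q * \<rho> ^ (k * grid N J (of_rat v)))"
  using assms(2) unfolding r'_def
proof (induction d arbitrary: r)
  case (Cons vq d)
  obtain v q where vq: "vq = (v, q)" by (cases vq)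
  obtain a b where r: "r = (a, b)" by (cases r)
  define t where "t = k * grid N J (of_rat v)"
  obtain qn qd where q: "quotient_of q = (qn, qd)" by fastforce
  have qd: "0 < qd" using quotient_of_denom_pos[OF q] .
  let ?s = "transform_step k N J vq r"
  have s: "?s = (a * (qd * int N ^ t) + b * (qn * (int N - 1) ^ t), b * (qd * int N ^ t))"
    by (simp add: vq r q t_def Let_def)
  have b: "0 < b" using Cons.prems r by simp
  have pos: "0 < snd ?s" using b qd N by (simp add: s)
  have "(of_rat q :: real) = qn / qd" using quotient_of_div[OF q] by (simp add: of_rat_divide)
  moreover have "\<rho> = (real N - 1) / N" using N by (simp add: \<rho>_def field_simps)
  then have "\<rho> ^ t = (real N - 1) ^ t / real N ^ t" by (simp add: power_divide)
  ultimately have "real_of_int (fst ?s) / real_of_int (snd ?s) = a / b + of_rat q * \<rho> ^ t"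
    using b qd N unfolding s by (simp add: field_simps)
  then show ?case using Cons.IH[OF pos] by (simp add: vq r t_def)
qed simp

lemma transform_eq:
  fixes N :: nat
  assumes "0 < N"
  shows "0 < snd (transform k N J d)"
    and "real_of_int (fst (transform k N J d)) / real_of_int (snd (transform k N J d)) =
      (\<Sum>(v, q)\<leftarrow>d. of_rat q * (1 - 1 / real N) ^ (k * grid N J (of_rat v)))"
  using transform_fold[of N "(0, 1)" k J d] assms unfolding transform_def by auto

lemma expectation_pmf_of_list:
  assumes "pmf_of_list_wf xs"
  shows "measure_pmf.expectation (pmf_of_list xs) f = (\<Sum>(v, q)\<leftarrow>xs. q * f v)"
proof -
  \<comment> \<open>A value may occur several times in the list, so its mass is a sum over entries.
    The index set is an arbitrary finite superset of the values because they change during the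
    induction.\<close>
  have *: "finite A \<Longrightarrow> fst ` set ys \<subseteq> A \<Longrightarrow>
      (\<Sum>a\<in>A. f a * sum_list (map snd (filter (\<lambda>z. fst z = a) ys))) = (\<Sum>(v, q)\<leftarrow>ys. q * f v)" for A ys
  proof (induction ys)
    case (Cons y ys)
    have "(\<Sum>a\<in>A. f a * sum_list (map snd (filter (\<lambda>z. fst z = a) (y # ys)))) =
        (\<Sum>a\<in>A. (if a = fst y then f a * snd y else 0)
          + f a * sum_list (map snd (filter (\<lambda>z. fst z = a) ys)))"
      by (intro sum.cong) (auto simp: algebra_simps)
    also have "\<dots> = snd y * f (fst y) + (\<Sum>(v, q)\<leftarrow>ys. q * f v)"
      using Cons by (simp add: sum.distrib mult.commute)
    finally show ?case by (simp add: case_prod_unfold)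
  qed simp
  have "measure_pmf.expectation (pmf_of_list xs) f =
      (\<Sum>a\<in>set (map fst xs). f a * pmf (pmf_of_list xs) a)"
    by (rule integral_measure_pmf_real) (use set_pmf_of_list[OF assms] in auto)
  also have "\<dots> = (\<Sum>(v, q)\<leftarrow>xs. q * f v)"
    unfolding pmf_pmf_of_list[OF assms] by (rule *) auto
  finally show ?thesis .
qed

text \<open>The number that \<open>transform\<close> represents as a fraction, written as an
  expectation so that independence can be applied to it.\<close>

definition transform_value :: "nat \<Rightarrow> nat \<Rightarrow> nat \<Rightarrow> distribution \<Rightarrow> real" where
  "transform_value k N J d = measure_pmf.expectation (pmf_of_list (real_distribution d))
     (\<lambda>x. (1 - 1 / real N) ^ (k * grid N J x))"

lemma transform_value_eq:
  assumes "0 < N" and "valid_distribution d"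
  shows "transform_value k N J d =
    real_of_int (fst (transform k N J d)) / real_of_int (snd (transform k N J d))"
proof -
  have "pmf_of_list_wf (real_distribution d)" using assms unfolding valid_distribution_def by blast
  then show ?thesis
    using assms
    by (simp add: transform_value_def expectation_pmf_of_list transform_eq real_distribution_def
        comp_def case_prod_unfold)
qed

text \<open>The upper bound provides the hypothesis \<open>a \<le> b\<close> of
  \<open>level_approximates\<close>, the lower one the nonnegativity in
  \<open>product_error\<close>.\<close>

lemma transform_value_bounds:
  assumes "0 < N" and "valid_distribution d"
  shows "0 \<le> transform_value k N J d" and "transform_value k N J d \<le> 1"
proof -
  have wf: "pmf_of_list_wf (real_distribution d)"
    using assms unfolding valid_distribution_def by blast
  have \<rho>: "0 \<le> 1 - 1 / real N" "1 - 1 / real N \<le> 1" using assms by auto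
  show "0 \<le> transform_value k N J d"
    unfolding transform_value_def using \<rho> by (intro Bochner_Integration.integral_nonneg) auto
  have "transform_value k N J d \<le> measure_pmf.expectation (pmf_of_list (real_distribution d)) (\<lambda>_. 1)"
    unfolding transform_value_def using \<rho> wf
    by (intro integral_mono integrable_measure_pmf_finite finite_set_pmf_of_list) (auto intro: power_le_one)
  then show "transform_value k N J d \<le> 1" by simp
qed

lemma expected_utility_error:
  fixes cs :: "int list" and H n D N J :: nat
  assumes valid: "\<forall>d\<in>set ds. valid_distribution d" and S: "S \<subseteq> {..<length ds}" and "0 < H"
    and approx: "\<And>x. 0 \<le> x \<Longrightarrow> \<bar>\<mu> x - (\<Sum>k<length cs. of_int (cs ! k) / D * exp (- x) ^ k)\<bar> \<le> e"
    and N: "N = H * (length ds + 2)" and J: "J = H * N"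
  shows "\<bar>expected_utility \<mu> ds S -
      (\<Sum>k<length cs. of_int (cs ! k) / D * (\<Prod>b\<in>S. transform_value k N J (ds ! b)))\<bar>
    \<le> e + (\<Sum>k<length cs. \<bar>of_int (cs ! k) / D\<bar> * k) / H"
proof -
  define c where "c k = real_of_int (cs ! k) / D" for k
  define p where "p b = pmf_of_list (real_distribution (ds ! b))" for b
  define \<rho> where "\<rho> = 1 - 1 / real N"
  define g where "g X = (\<Sum>b\<in>S. grid N J (X b))" for X :: "nat \<Rightarrow> real"
  have "0 < N" using \<open>0 < H\<close> by (simp add: N)
  then have \<rho>: "0 \<le> \<rho>" "\<rho> \<le> 1" by (auto simp: \<rho>_def)
  have fS: "finite S" "card S \<le> length ds"
    using S finite_subset card_mono[of "{..<length ds}" S] by auto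
  have wf: "pmf_of_list_wf (real_distribution (ds ! b))" if "b < length ds" for b
    using valid that unfolding valid_distribution_def by auto
  have nonneg: "0 \<le> v" if "b < length ds" "v \<in> set_pmf (p b)" for b v
  proof -
    have "v \<in> fst ` set (real_distribution (ds ! b))"
      using set_pmf_of_list[OF wf[OF that(1)]] that(2) by (auto simp: p_def)
    then obtain v' q where "(v', q) \<in> set (ds ! b)" "v = of_rat v'"
      by (auto simp: real_distribution_def)
    moreover have "valid_distribution (ds ! b)" using valid that by auto
    ultimately show ?thesis unfolding valid_distribution_def by fastforce
  qed
  have weights: "weights_pmf ds = Pi_pmf {..<length ds} 0 p"
    by (simp add: weights_pmf_def p_def[abs_def])
  have X: "0 \<le> X b" if "X \<in> set_pmf (weights_pmf ds)" "b \<in> S" for X b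
    using that S nonneg[of b "X b"] by (auto simp: weights set_Pi_pmf PiE_dflt_def)
  \<comment> \<open>With finite support every function of the weights is integrable, whatever the
    utility is on negative arguments.\<close>
  have "finite (set_pmf (weights_pmf ds))"
    unfolding weights
    by (simp add: set_Pi_pmf) (intro finite_PiE_dflt, auto simp: p_def intro: finite_set_pmf_of_list wf)
  then have int: "integrable (measure_pmf (weights_pmf ds)) f" for f :: "_ \<Rightarrow> real"
    by (rule integrable_measure_pmf_finite)
  have prod: "(\<Prod>b\<in>S. transform_value k N J (ds ! b)) =
      measure_pmf.expectation (weights_pmf ds) (\<lambda>X. (\<rho> ^ g X) ^ k)" for k
  proof -
    \<comment> \<open>Independence gives the expectation of a product over the whole ground set, so
      elements outside \<open>S\<close> contribute the factor \<open>1\<close>.\<close>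
    define f where "f b x = (if b \<in> S then \<rho> ^ (k * grid N J x) else 1)" for b and x :: real
    have "measure_pmf.expectation (weights_pmf ds) (\<lambda>X. \<Prod>b<length ds. f b (X b)) =
        (\<Prod>b<length ds. measure_pmf.expectation (p b) (f b))"
      unfolding weights
      by (rule expectation_prod_Pi_pmf)
        (use \<rho> in \<open>auto simp: f_def p_def intro!: integrable_measure_pmf_finite finite_set_pmf_of_list wf\<close>)
    moreover have "(\<Prod>b<length ds. f b (X b)) = (\<rho> ^ g X) ^ k" for X
    proof -
      have "(\<Prod>b<length ds. f b (X b)) = (\<Prod>b\<in>S. f b (X b))"
        using S by (intro prod.mono_neutral_right) (auto simp: f_def)
      also have "\<dots> = (\<Prod>b\<in>S. \<rho> ^ (k * grid N J (X b)))" by (intro prod.cong) (auto simp: f_def)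
      also have "\<dots> = (\<rho> ^ g X) ^ k"
        by (simp add: g_def mult.commute[of k] flip: power_sum power_mult sum_distrib_left sum_distrib_right)
      finally show ?thesis .
    qed
    moreover have "f b = (\<lambda>_. 1)" if "b \<notin> S" for b using that by (simp add: f_def[abs_def])
    then have "(\<Prod>b<length ds. measure_pmf.expectation (p b) (f b)) =
        (\<Prod>b\<in>S. measure_pmf.expectation (p b) (f b))"
      using S by (intro prod.mono_neutral_right) auto
    moreover have "\<dots> = (\<Prod>b\<in>S. transform_value k N J (ds ! b))"
      by (intro prod.cong) (auto simp: transform_value_def f_def[abs_def] p_def \<rho>_def)
    ultimately show ?thesis by simp
  qed
  let ?q = "\<lambda>y. \<Sum>k<length cs. c k * y ^ k"
  have pointwise: "\<bar>\<mu> (\<Sum>b\<in>S. X b) - ?q (\<rho> ^ g X)\<bar> \<le> e + (\<Sum>k<length cs. \<bar>c k\<bar> * k) / H"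
    if "X \<in> set_pmf (weights_pmf ds)" for X
  proof -
    define x where "x = (\<Sum>b\<in>S. X b)"
    have "0 \<le> x" unfolding x_def by (intro sum_nonneg X that)
    have "\<bar>\<rho> ^ g X - exp (- x)\<bar> \<le> 1 / H"
      unfolding \<rho>_def g_def x_def
      by (rule grid_error[OF fS _ \<open>0 < H\<close> N J]) (use X that in auto)
    then have "\<bar>c k * exp (- x) ^ k - c k * (\<rho> ^ g X) ^ k\<bar> \<le> \<bar>c k\<bar> * k * (1 / H)" for k
    proof -
      have "\<bar>exp (- x) ^ k - (\<rho> ^ g X) ^ k\<bar> \<le> k * \<bar>exp (- x) - \<rho> ^ g X\<bar>"
        using \<rho> \<open>0 \<le> x\<close> by (intro abs_power_diff_le) (auto intro: power_le_one)
      also have "\<dots> \<le> k * (1 / H)"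
        using \<open>\<bar>\<rho> ^ g X - exp (- x)\<bar> \<le> 1 / H\<close> by (intro mult_left_mono) (auto simp: abs_minus_commute)
      finally have "\<bar>c k\<bar> * \<bar>exp (- x) ^ k - (\<rho> ^ g X) ^ k\<bar> \<le> \<bar>c k\<bar> * (k * (1 / H))"
        by (intro mult_left_mono) auto
      then show ?thesis by (simp add: mult.assoc flip: abs_mult right_diff_distrib)
    qed
    then have "\<bar>\<Sum>k<length cs. c k * exp (- x) ^ k - c k * (\<rho> ^ g X) ^ k\<bar>
        \<le> (\<Sum>k<length cs. \<bar>c k\<bar> * k * (1 / H))"
      by (intro order_trans[OF sum_abs] sum_mono)
    then have "\<bar>?q (exp (- x)) - ?q (\<rho> ^ g X)\<bar> \<le> (\<Sum>k<length cs. \<bar>c k\<bar> * k) / H"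
      by (simp add: sum_subtractf sum_divide_distrib)
    moreover have "\<bar>\<mu> x - ?q (exp (- x))\<bar> \<le> e" using approx[OF \<open>0 \<le> x\<close>] by (simp add: c_def)
    ultimately show ?thesis unfolding x_def[symmetric] by linarith
  qed
  have "expected_utility \<mu> ds S - (\<Sum>k<length cs. c k * (\<Prod>b\<in>S. transform_value k N J (ds ! b))) =
      measure_pmf.expectation (weights_pmf ds) (\<lambda>X. \<mu> (\<Sum>b\<in>S. X b) - ?q (\<rho> ^ g X))"
    unfolding expected_utility_def prod using int by simp
  also have "\<bar>\<dots>\<bar> \<le> measure_pmf.expectation (weights_pmf ds) (\<lambda>X. \<bar>\<mu> (\<Sum>b\<in>S. X b) - ?q (\<rho> ^ g X)\<bar>)"
    by (rule integral_abs_bound)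
  also have "\<dots> \<le> measure_pmf.expectation (weights_pmf ds) (\<lambda>_. e + (\<Sum>k<length cs. \<bar>c k\<bar> * k) / H)"
    by (intro integral_mono_AE int AE_pmfI pointwise)
  finally show ?thesis by (simp add: c_def)
qed

section \<open>Correctness of the selected solution\<close>

lemma sum_horner_sum_Cons:
  fixes w :: "'b \<Rightarrow> 'k \<Rightarrow> nat"
  shows "(\<Sum>b\<in>S. horner_sum (w b) B (k # ks)) =
    (\<Sum>b\<in>S. w b k) + B * (\<Sum>b\<in>S. horner_sum (w b) B ks)"
  by (simp add: sum.distrib sum_distrib_left)

lemma sum_horner_sum_less:
  fixes w :: "'b \<Rightarrow> 'k \<Rightarrow> nat"
  assumes "\<And>k. (\<Sum>b\<in>S. w b k) < B"
  shows "(\<Sum>b\<in>S. horner_sum (w b) B ks) < B ^ length ks"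
proof (induction ks)
  case (Cons k ks)
  have "(\<Sum>b\<in>S. w b k) + B * (\<Sum>b\<in>S. horner_sum (w b) B ks)
      < B + B * (\<Sum>b\<in>S. horner_sum (w b) B ks)"
    using assms by simp
  also have "\<dots> = B * Suc (\<Sum>b\<in>S. horner_sum (w b) B ks)" by simp
  also have "\<dots> \<le> B * B ^ length ks" using Cons by (intro mult_left_mono Suc_leI) auto
  finally show ?case by (simp only: sum_horner_sum_Cons length_Cons power_Suc)
qed simp

text \<open>Every digit sum stays below \<open>B\<close>, so adding weights produces no carry and
  the digits of the total are the sums for the individual \<open>k\<close>. The offset
  \<open>m\<close> is for the induction, which removes the lowest digit.\<close>

lemma gain_eq:
  fixes w :: "'b \<Rightarrow> nat \<Rightarrow> nat" and N B :: nat
  assumes "0 < N" and less: "\<And>k. (\<Sum>b\<in>S. w b k) < B"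
  shows "real_of_int (gain cs N B (\<Sum>b\<in>S. horner_sum (w b) B [m..<m + length cs])) =
    real N ^ B * (\<Sum>k<length cs. of_int (cs ! k) * (1 - 1 / real N) ^ (\<Sum>b\<in>S. w b (m + k)))"
proof (induction cs arbitrary: m)
  case (Cons c cs)
  define t where "t = (\<Sum>b\<in>S. w b m)"
  define R where "R = (\<Sum>b\<in>S. horner_sum (w b) B [Suc m..<Suc m + length cs])"
  have t: "t < B" using less by (simp add: t_def)
  have "[m..<m + length (c # cs)] = m # [Suc m..<Suc m + length cs]"
    using upt_conv_Cons[of m "m + length (c # cs)"] by simp
  then have K: "(\<Sum>b\<in>S. horner_sum (w b) B [m..<m + length (c # cs)]) = t + B * R"
    unfolding t_def R_def by (simp only: sum_horner_sum_Cons)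
  have digits: "(t + B * R) mod B = t" "(t + B * R) div B = R"
    using t by (auto simp: div_mult_self2)
  have N: "real N ^ B = real N ^ t * real N ^ (B - t)" using t by (simp flip: power_add)
  have "(real N - 1) ^ t = real N ^ t * (1 - 1 / real N) ^ t"
    using \<open>0 < N\<close> by (simp add: right_diff_distrib flip: power_mult_distrib)
  then have "(real N - 1) ^ t * real N ^ (B - t) = real N ^ B * (1 - 1 / real N) ^ t"
    by (simp add: N)
  then have "real_of_int (gain (c # cs) N B (t + B * R)) =
      of_int c * (real N ^ B * (1 - 1 / real N) ^ t) + real_of_int (gain cs N B R)"
    by (simp add: digits t)
  also have "real_of_int (gain cs N B R) = real N ^ B *
      (\<Sum>k<length cs. of_int (cs ! k) * (1 - 1 / real N) ^ (\<Sum>b\<in>S. w b (Suc m + k)))"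
    unfolding R_def by (rule Cons.IH)
  also have "of_int c * (real N ^ B * (1 - 1 / real N) ^ t) + \<dots> =
      real N ^ B * (\<Sum>k<length (c # cs). of_int ((c # cs) ! k) * (1 - 1 / real N) ^ (\<Sum>b\<in>S. w b (m + k)))"
    by (simp add: sum.lessThan_Suc_shift t_def algebra_simps del: sum.lessThan_Suc)
  finally show ?case by (simp only: K)
qed simp

section \<open>Parameters of the reduction and the approximate objective\<close>

definition grid_points :: "nat \<Rightarrow> distribution list \<Rightarrow> nat" where
  "grid_points H ds = H * (length ds + 2)"

text \<open>The cap for grid values, where it stands for a weight of \<open>H\<close>, and at the
  same time for rounded logarithms.\<close>

definition max_level :: "nat \<Rightarrow> distribution list \<Rightarrow> nat" where
  "max_level H ds = H * grid_points H ds"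

text \<open>The product is the largest digit sum that a solution can reach; one more prevents
  carries.\<close>

definition base :: "nat \<Rightarrow> distribution list \<Rightarrow> nat" where
  "base H ds = length ds * max_level H ds + 1"

definition item_level :: "nat \<Rightarrow> distribution list \<Rightarrow> distribution \<Rightarrow> nat \<Rightarrow> nat" where
  "item_level H ds d k = level (grid_points H ds)
     (transform k (grid_points H ds) (max_level H ds) d) (max_level H ds)"

definition item_weight :: "nat \<Rightarrow> nat \<Rightarrow> distribution list \<Rightarrow> distribution \<Rightarrow> nat" where
  "item_weight H L ds d = horner_sum (item_level H ds d) (base H ds) [0..<L]"

definition total_weight :: "nat \<Rightarrow> nat \<Rightarrow> distribution list \<Rightarrow> nat set \<Rightarrow> nat" where
  "total_weight H L ds S = (\<Sum>b\<in>S. item_weight H L ds (ds ! b))"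

text \<open>This is \<open>D\<close> times the approximate utility; a common denominator does not
  affect comparisons.\<close>

definition objective :: "nat \<Rightarrow> int list \<Rightarrow> distribution list \<Rightarrow> nat set \<Rightarrow> real" where
  "objective H cs ds S = (\<Sum>k<length cs. of_int (cs ! k) *
     (1 - 1 / real (grid_points H ds)) ^ (\<Sum>b\<in>S. item_level H ds (ds ! b) k))"

lemma grid_points_pos: "0 < H \<Longrightarrow> 0 < grid_points H ds"
  by (simp add: grid_points_def)

lemma sum_item_level_less:
  assumes "S \<subseteq> {..<length ds}"
  shows "(\<Sum>b\<in>S. item_level H ds (ds ! b) k) < base H ds"
proof -
  have "(\<Sum>b\<in>S. item_level H ds (ds ! b) k) \<le> (\<Sum>b\<in>S. max_level H ds)"
    unfolding item_level_def by (intro sum_mono level_le)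
  also have "\<dots> \<le> length ds * max_level H ds"
    using card_mono[OF _ assms] by simp
  finally show ?thesis by (simp add: base_def)
qed

lemma total_weight_less:
  assumes "S \<subseteq> {..<length ds}"
  shows "total_weight H L ds S < base H ds ^ L"
  unfolding total_weight_def item_weight_def
  using sum_horner_sum_less[of "\<lambda>b. item_level H ds (ds ! b)" S "base H ds" "[0..<L]"]
    sum_item_level_less[OF assms] by simp

lemma gain_total_weight:
  assumes "0 < H" "S \<subseteq> {..<length ds}"
  shows "real_of_int (gain cs (grid_points H ds) (base H ds) (total_weight H (length cs) ds S)) =
    real (grid_points H ds) ^ base H ds * objective H cs ds S"
proof -
  have "0 < grid_points H ds" using assms by (simp add: grid_points_def)
  from gain_eq[OF this, of "\<lambda>b. item_level H ds (ds ! b)" S "base H ds" cs 0,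
      OF sum_item_level_less[OF assms(2)]]
  show ?thesis by (simp add: total_weight_def item_weight_def objective_def)
qed

text \<open>Serves to keep the score of unsolvable targets below that of all solvable ones.\<close>

lemma objective_lower_bound:
  assumes "0 < H"
  shows "- (\<Sum>k<length cs. \<bar>real_of_int (cs ! k)\<bar>) \<le> objective H cs ds S"
proof -
  have \<rho>: "0 \<le> 1 - 1 / real (grid_points H ds)" "1 - 1 / real (grid_points H ds) \<le> 1"
    using grid_points_pos[OF assms, of ds] by auto
  have "\<bar>objective H cs ds S\<bar> \<le> (\<Sum>k<length cs. \<bar>real_of_int (cs ! k)\<bar>)"
    unfolding objective_def
  proof (intro order_trans[OF sum_abs] sum_mono)
    fix k
    have "(1 - 1 / real (grid_points H ds)) ^ m \<le> 1" for m using \<rho> by (intro power_le_one)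
    then show "\<bar>of_int (cs ! k) * (1 - 1 / real (grid_points H ds)) ^
        (\<Sum>b\<in>S. item_level H ds (ds ! b) k)\<bar> \<le> \<bar>real_of_int (cs ! k)\<bar>"
      using \<rho> by (auto simp: abs_mult intro: mult_left_le)
  qed
  then show ?thesis by linarith
qed

text \<open>In the factor \<open>k + 1\<close>, the part \<open>k\<close> comes from discretizing
  the weights inside a \<open>k\<close>-th power and the part \<open>1\<close> from rounding the
  logarithms.\<close>

lemma objective_error:
  fixes cs :: "int list" and D H :: nat
  assumes valid: "\<forall>d\<in>set ds. valid_distribution d" and S: "S \<subseteq> {..<length ds}" and "0 < H"
    and approx: "\<And>x. 0 \<le> x \<Longrightarrow> \<bar>\<mu> x - (\<Sum>k<length cs. of_int (cs ! k) / D * exp (- x) ^ k)\<bar> \<le> e"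
  shows "\<bar>expected_utility \<mu> ds S - objective H cs ds S / D\<bar>
    \<le> e + (\<Sum>k<length cs. \<bar>of_int (cs ! k) / D\<bar> * (k + 1)) / H"
proof -
  define N J where "N = grid_points H ds" and "J = max_level H ds"
  define \<rho> where "\<rho> = 1 - 1 / real N"
  define c where "c k = real_of_int (cs ! k) / D" for k
  define T where "T k = (\<Prod>b\<in>S. transform_value k N J (ds ! b))" for k
  define t where "t k = (\<Sum>b\<in>S. item_level H ds (ds ! b) k)" for k
  have "0 < N" using \<open>0 < H\<close> by (simp add: N_def grid_points_def)
  have J: "J = H * N" by (simp add: J_def N_def max_level_def)
  have "\<bar>T k - \<rho> ^ t k\<bar> \<le> 1 / H" for k
    unfolding T_def t_def
  proof (rule product_error[where J = J and n = "length ds"])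
    show "finite S" "card S \<le> length ds"
      using S finite_subset card_mono[of "{..<length ds}" S] by auto
    show "0 \<le> \<rho>" "\<rho> \<le> 1" using \<open>0 < N\<close> by (auto simp: \<rho>_def)
    have "\<rho> ^ J \<le> exp (- (real J / N))" unfolding \<rho>_def using \<open>0 < N\<close> by (rule power_le_exp)
    also have "real J / N = H" using \<open>0 < N\<close> by (simp add: J)
    also have "exp (- real H) \<le> 1 / H" using \<open>0 < H\<close> by (intro exp_minus_le_inverse) simp
    finally show "\<rho> ^ J \<le> 1 / H" .
    have "length ds * H \<le> N" by (simp add: N_def grid_points_def)
    then have "real (length ds) * real H \<le> N" by (simp flip: of_nat_mult)
    then show "length ds * (1 - \<rho>) \<le> 1 / H"
      using \<open>0 < H\<close> \<open>0 < N\<close> by (simp add: \<rho>_def field_simps)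
    fix b assume "b \<in> S"
    then have d: "valid_distribution (ds ! b)" using valid S by auto
    obtain x y where xy: "transform k N J (ds ! b) = (x, y)" by fastforce
    have y: "0 < y" using transform_eq(1)[OF \<open>0 < N\<close>, of k J "ds ! b"] xy by simp
    have e: "transform_value k N J (ds ! b) = x / y"
      using transform_value_eq[OF \<open>0 < N\<close> d, of k J] xy by simp
    note bounds = transform_value_bounds[OF \<open>0 < N\<close> d, of k J]
    then have "x \<le> y" using y by (simp add: e)
    note level = level_approximates[OF \<open>0 < N\<close> y this, of J, folded \<rho>_def]
    have w: "item_level H ds (ds ! b) k = level N (x, y) J"
      by (simp add: item_level_def xy flip: N_def J_def)
    show "0 \<le> transform_value k N J (ds ! b) \<and>
        transform_value k N J (ds ! b) \<le> \<rho> ^ item_level H ds (ds ! b) k"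
      using bounds level(1) by (simp add: w e)
    show "item_level H ds (ds ! b) k = J \<or>
        \<rho> ^ Suc (item_level H ds (ds ! b) k) < transform_value k N J (ds ! b)"
      using level(2) unfolding w e .
  qed
  then have "\<bar>c k * T k - c k * \<rho> ^ t k\<bar> \<le> \<bar>c k\<bar> * (1 / H)" for k
    by (simp only: abs_mult flip: right_diff_distrib) (intro mult_left_mono, auto)
  then have "\<bar>\<Sum>k<length cs. c k * T k - c k * \<rho> ^ t k\<bar> \<le> (\<Sum>k<length cs. \<bar>c k\<bar> * (1 / H))"
    by (intro order_trans[OF sum_abs] sum_mono)
  then have "\<bar>(\<Sum>k<length cs. c k * T k) - (\<Sum>k<length cs. c k * \<rho> ^ t k)\<bar> \<le> (\<Sum>k<length cs. \<bar>c k\<bar>) / H"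
    by (simp add: sum_subtractf sum_divide_distrib)
  moreover have "\<bar>expected_utility \<mu> ds S - (\<Sum>k<length cs. c k * T k)\<bar>
      \<le> e + (\<Sum>k<length cs. \<bar>c k\<bar> * k) / H"
    unfolding c_def T_def
    by (rule expected_utility_error[OF valid S \<open>0 < H\<close> approx])
      (simp_all add: N_def J grid_points_def)
  moreover have "objective H cs ds S / D = (\<Sum>k<length cs. c k * \<rho> ^ t k)"
    by (simp add: objective_def c_def \<rho>_def N_def t_def sum_divide_distrib)
  moreover have "(\<Sum>k<length cs. \<bar>c k\<bar>) / H + (\<Sum>k<length cs. \<bar>c k\<bar> * k) / H =
      (\<Sum>k<length cs. \<bar>c k\<bar> * (k + 1)) / H"
    by (simp add: sum.distrib algebra_simps add_divide_distrib)
  ultimately show ?thesis unfolding c_def by linarith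
qed

definition item_weights :: "nat \<Rightarrow> nat \<Rightarrow> distribution list \<Rightarrow> int list" where
  "item_weights H L ds = map (\<lambda>d. int (item_weight H L ds d)) ds"

text \<open>An unsolvable target is scored one unit below the least conceivable objective, on the
  scale \<open>N ^ B\<close> of \<open>gain\<close>.\<close>

definition score :: "problem \<Rightarrow> prog \<Rightarrow> nat \<Rightarrow> int list \<Rightarrow> data \<Rightarrow> distribution list \<Rightarrow> nat \<Rightarrow> int" where
  "score A p H cs x ds K =
     (case exact_answer A p x (item_weights H (length cs) ds) K of
        Node _ _ \<Rightarrow> gain cs (grid_points H ds) (base H ds) K
      | Atom _ \<Rightarrow> (- 1 - (\<Sum>c\<leftarrow>cs. \<bar>c\<bar>)) * int (grid_points H ds) ^ base H ds)"

definition best_target :: "problem \<Rightarrow> prog \<Rightarrow> nat \<Rightarrow> int list \<Rightarrow> data \<Rightarrow> distribution list \<Rightarrow> nat" where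
  "best_target A p H cs x ds =
     argmax (score A p H cs x ds) (base H ds ^ length cs) (base H ds ^ length cs)"

definition selected :: "problem \<Rightarrow> prog \<Rightarrow> nat \<Rightarrow> int list \<Rightarrow> data \<Rightarrow> distribution list \<Rightarrow> data" where
  "selected A p H cs x ds =
     exact_answer A p x (item_weights H (length cs) ds) (best_target A p H cs x ds)"

text \<open>The total weight of every feasible set is among the targets, and the objective of a set
  depends only on its total weight. So it does not matter which of the solutions of a given total
  the exact algorithm returns.\<close>

lemma selected_solution:
  assumes A: "combinatorial_problem A" and p: "pseudopolynomial_exact A p" and "0 < H"
    and x: "x \<in> instances A" and ds: "length ds = ground_size A x" and F: "feasible A x \<noteq> {}"
  obtains S where "S \<in> feasible A x"
    and "selected A p H cs x ds = Node (Atom 1) (enc_subset (ground_size A x) S)"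
    and "\<And>S'. S' \<in> feasible A x \<Longrightarrow> objective H cs ds S' \<le> objective H cs ds S"
proof -
  define ws where "ws = item_weights H (length cs) ds"
  define NB where "NB = real (grid_points H ds) ^ base H ds"
  define K where "K = best_target A p H cs x ds"
  have NB: "0 < NB" using grid_points_pos[OF \<open>0 < H\<close>, of ds] by (simp add: NB_def)
  have subset: "S \<subseteq> {..<length ds}" if "S \<in> feasible A x" for S
    using A x ds that unfolding combinatorial_problem_def by auto
  have sum: "(\<Sum>b\<in>S. ws ! b) = int (total_weight H (length cs) ds S)" if "S \<in> feasible A x" for S
  proof -
    have "(\<Sum>b\<in>S. ws ! b) = (\<Sum>b\<in>S. int (item_weight H (length cs) ds (ds ! b)))"
      using subset[OF that] by (intro sum.cong) (auto simp: ws_def item_weights_def)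
    then show ?thesis by (simp add: total_weight_def)
  qed
  have exact: "exact_answer A p x ws K' \<in> exact_answers A x ws (int K')" for K'
    using exact_answer[OF p] x ds by (metis (no_types, lifting) ws_def item_weights_def
      length_map imageE list.set_map of_nat_0_le_iff)
  have cases: "(exact_answer A p x ws K' = Atom 0 \<and> exact_solutions A x ws (int K') = {}) \<or>
      (\<exists>S\<in>exact_solutions A x ws (int K'). exact_answer A p x ws K' =
         Node (Atom 1) (enc_subset (ground_size A x) S))" for K'
    using exact[of K'] unfolding exact_answers_def by (auto split: if_splits)
  have score: "objective H cs ds S * NB = score A p H cs x ds (total_weight H (length cs) ds S)"
    if "S \<in> feasible A x" for S
  proof -
    have "S \<in> exact_solutions A x ws (int (total_weight H (length cs) ds S))"
      using that sum[OF that] by (simp add: exact_solutions_def)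
    then show ?thesis
      using cases[of "total_weight H (length cs) ds S"]
        gain_total_weight[OF \<open>0 < H\<close> subset[OF that], of cs]
      by (auto simp: score_def ws_def NB_def mult.commute)
  qed
  have max: "score A p H cs x ds (total_weight H (length cs) ds S) \<le> score A p H cs x ds K"
    if "S \<in> feasible A x" for S
    unfolding K_def best_target_def by (rule argmax_ge[OF total_weight_less[OF subset[OF that]]])
  \<comment> \<open>Otherwise the maximal score would be the penalty, although any feasible set
    yields a larger one.\<close>
  have "exact_solutions A x ws (int K) \<noteq> {}"
  proof
    assume "exact_solutions A x ws (int K) = {}"
    then have "exact_answer A p x ws K = Atom 0" using cases[of K] by auto
    then have "real_of_int (score A p H cs x ds K) = (- 1 - (\<Sum>c\<leftarrow>cs. \<bar>c\<bar>)) * NB"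
      by (simp add: score_def ws_def NB_def)
    also have "(\<Sum>c\<leftarrow>cs. \<bar>c\<bar>) = (\<Sum>k<length cs. \<bar>cs ! k\<bar>)"
      by (simp add: sum_list_sum_nth lessThan_atLeast0)
    finally have *: "real_of_int (score A p H cs x ds K) =
        (- 1 - (\<Sum>k<length cs. \<bar>real_of_int (cs ! k)\<bar>)) * NB" by simp
    obtain S where S: "S \<in> feasible A x" using F by blast
    have "objective H cs ds S * NB \<le> (- 1 - (\<Sum>k<length cs. \<bar>real_of_int (cs ! k)\<bar>)) * NB"
      unfolding *[symmetric] score[OF S] using max[OF S] by simp
    then have "objective H cs ds S \<le> - 1 - (\<Sum>k<length cs. \<bar>real_of_int (cs ! k)\<bar>)"
      using NB by simp
    then show False using objective_lower_bound[OF \<open>0 < H\<close>, of cs ds S] by linarith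
  qed
  then obtain S where S: "S \<in> exact_solutions A x ws (int K)"
    "exact_answer A p x ws K = Node (Atom 1) (enc_subset (ground_size A x) S)"
    using cases[of K] by auto
  then have "S \<in> feasible A x" and "K = total_weight H (length cs) ds S"
    using sum[of S] by (auto simp: exact_solutions_def)
  show thesis
  proof (rule that)
    show "S \<in> feasible A x" by fact
    show "selected A p H cs x ds = Node (Atom 1) (enc_subset (ground_size A x) S)"
      using S(2) by (simp add: selected_def ws_def K_def)
    fix S' assume S': "S' \<in> feasible A x"
    have "objective H cs ds S' * NB \<le> objective H cs ds S * NB"
      unfolding score[OF S'] score[OF \<open>S \<in> feasible A x\<close>]
      using max[OF S'] \<open>K = total_weight H (length cs) ds S\<close> by simp
    then show "objective H cs ds S' \<le> objective H cs ds S" using NB by simp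
  qed
qed

lemma selected_correct:
  fixes cs :: "int list" and D H :: nat
  assumes A: "combinatorial_problem A" and p: "pseudopolynomial_exact A p" and "0 < H" "0 < D"
    and approx: "\<And>x. 0 \<le> x \<Longrightarrow>
      \<bar>\<mu> x - (\<Sum>k<length cs. of_int (cs ! k) / D * exp (- x) ^ k)\<bar> \<le> \<epsilon> / 4"
    and H: "(\<Sum>k<length cs. \<bar>of_int (cs ! k) / D\<bar> * (k + 1)) / H \<le> \<epsilon> / 4"
    and x: "x \<in> instances A" and ds: "length ds = ground_size A x"
    and valid: "\<forall>d\<in>set ds. valid_distribution d"
  shows "(case selected A p H cs x ds of Atom a \<Rightarrow> Atom a | Node _ v \<Rightarrow> v) \<in> eum_answers A \<mu> \<epsilon> x ds"
proof (cases "feasible A x = {}")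
  case True
  then show ?thesis by (simp add: eum_answers_def)
next
  case False
  obtain S where S: "S \<in> feasible A x"
    "selected A p H cs x ds = Node (Atom 1) (enc_subset (ground_size A x) S)"
    "\<And>S'. S' \<in> feasible A x \<Longrightarrow> objective H cs ds S' \<le> objective H cs ds S"
    using selected_solution[OF A p \<open>0 < H\<close> x ds False, of cs] by blast
  have subset: "S \<subseteq> {..<length ds}" if "S \<in> feasible A x" for S
    using A x ds that unfolding combinatorial_problem_def by auto
  \<comment> \<open>One \<open>\<epsilon> / 4\<close> is from the exponential sum, the other from
    the choice of \<open>H\<close>. The estimate is used twice below, for the selected and for an
    optimal set.\<close>
  have error: "\<bar>expected_utility \<mu> ds S' - objective H cs ds S' / D\<bar> \<le> \<epsilon> / 2"
    if "S' \<in> feasible A x" for S'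
    using objective_error[OF valid subset[OF that] \<open>0 < H\<close> approx] H by linarith
  have "feasible A x \<subseteq> Pow {..<length ds}" using subset by auto
  then have "finite (feasible A x)" by (rule finite_subset) simp
  then obtain S' where S': "S' \<in> feasible A x" "optimal_utility A \<mu> x ds = expected_utility \<mu> ds S'"
    unfolding optimal_utility_def
    using Max_in[of "expected_utility \<mu> ds ` feasible A x"] False
    by (metis (no_types, lifting) finite_imageI image_iff image_is_empty)
  have "objective H cs ds S' / D \<le> objective H cs ds S / D"
    using S(3)[OF S'(1)] by (intro divide_right_mono) auto
  then have "optimal_utility A \<mu> x ds - \<epsilon> \<le> expected_utility \<mu> ds S"
    using error[OF S(1)] error[OF S'(1)] S'(2) by linarith
  then show ?thesis using S(1) False by (auto simp: eum_answers_def S(2))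
qed

section \<open>The algorithm\<close>

text \<open>At the outermost level the environment is the input itself: \<open>Left\<close> is the
  instance and \<open>Right\<close> the list of distributions.\<close>

definition grid_points_prog :: "nat \<Rightarrow> prog" where
  "grid_points_prog H = op Times (Lit (int H)) (op Plus (list_length Right) (Lit (int 2)))"

definition max_level_prog :: "nat \<Rightarrow> prog" where
  "max_level_prog H = op Times (Lit (int H)) (grid_points_prog H)"

definition base_prog :: "nat \<Rightarrow> prog" where
  "base_prog H = op Plus (op Times (list_length Right) (max_level_prog H)) (Lit (int 1))"

definition item_weights_prog :: "nat \<Rightarrow> nat \<Rightarrow> prog" where
  "item_weights_prog H L = map_loop Right (horner_prog (outer (base_prog H))
     (map (\<lambda>k. level_prog (outer (grid_points_prog H))
        (transform_prog k (outer (grid_points_prog H)) (outer (max_level_prog H)) element)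
        (outer (max_level_prog H))) [0..<L]))"

text \<open>Written for the body of the maximization loop, hence one \<open>outer\<close> around
  everything but \<open>K\<close>. The weights are recomputed for each target, which is still
  polynomial.\<close>

definition score_prog :: "prog \<Rightarrow> nat \<Rightarrow> int list \<Rightarrow> prog \<Rightarrow> prog" where
  "score_prog p H cs K =
     Cond (Seq (Seq (Fork (outer Left) (Fork (outer (item_weights_prog H (length cs))) K)) p) Is_Node)
       (gain_prog cs (outer (grid_points_prog H)) (outer (base_prog H)) K)
       (op Times (Lit (- 1 - (\<Sum>c\<leftarrow>cs. \<bar>c\<bar>)))
         (pow (outer (grid_points_prog H)) (outer (base_prog H))))"

text \<open>The maximization returns only a target, so \<open>p\<close> is called once more to
  obtain a solution. \<open>Right\<close> strips the success tag; \<open>Skip\<close> passes on the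
  answer \<open>Atom 0\<close>, which arises if nothing is feasible.\<close>

definition eum_prog :: "prog \<Rightarrow> nat \<Rightarrow> int list \<Rightarrow> prog" where
  "eum_prog p H cs =
     Seq (Seq (Fork Left (Fork (item_weights_prog H (length cs))
         (argmax_prog (pow (base_prog H) (Lit (int (length cs)))) (score_prog p H cs)))) p)
       (Cond Is_Node Right Skip)"

definition eum_instances :: "problem \<Rightarrow> (data \<times> distribution list) set" where
  "eum_instances A = {(x, ds). x \<in> instances A \<and> length ds = ground_size A x \<and>
     (\<forall>d\<in>set ds. valid_distribution d)}"

abbreviation (input) input_of :: "data \<times> distribution list \<Rightarrow> data" where
  "input_of i \<equiv> eum_input (fst i) (snd i)"

abbreviation (input) input_size :: "data \<times> distribution list \<Rightarrow> nat" where
  "input_size i \<equiv> data_size (input_of i)"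

section \<open>Running time on the family of all instances\<close>

context
  fixes A :: problem and I :: "(data \<times> distribution list) set" and H :: nat
  defines "I \<equiv> eum_instances A"
begin

lemma evaluates_distributions:
  "evaluates I input_size Right input_of (\<lambda>i. enc_list (map enc_distribution (snd i)))"
  unfolding eum_input_def by (rule evaluates_Right)

lemma data_size_distributions:
  "data_size (enc_list (map enc_distribution (snd i))) \<le> input_size i"
  by (simp add: eum_input_def)

lemma poly_bounded_length: "poly_bounded I input_size (\<lambda>i. length (snd i))"
proof (rule poly_bounded_mono[OF poly_bounded_size])
  show "length (snd i) \<le> input_size i" for i
    using length_le_data_size[of "map enc_distribution (snd i)"] data_size_distributions[of i]
    by simp
qed

lemma evaluates_length: "evaluates_nat I input_size (list_length Right) input_of (\<lambda>i. length (snd i))"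
  using evaluates_list_length[OF evaluates_distributions] poly_bounded_length by simp

lemma evaluates_grid_points:
  "evaluates_nat I input_size (grid_points_prog H) input_of (\<lambda>i. grid_points H (snd i))"
  unfolding grid_points_prog_def grid_points_def
  by (intro evaluates_nat_times evaluates_nat_plus evaluates_nat_Lit evaluates_length)

lemma evaluates_max_level:
  "evaluates_nat I input_size (max_level_prog H) input_of (\<lambda>i. max_level H (snd i))"
  unfolding max_level_prog_def max_level_def
  by (intro evaluates_nat_times evaluates_nat_Lit evaluates_grid_points)

lemma evaluates_base: "evaluates_nat I input_size (base_prog H) input_of (\<lambda>i. base H (snd i))"
  unfolding base_prog_def base_def
  by (intro evaluates_nat_times evaluates_nat_plus evaluates_nat_Lit evaluates_length
      evaluates_max_level)

lemma evaluates_targets: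
  "evaluates_nat I input_size (pow (base_prog H) (Lit (int L))) input_of (\<lambda>i. base H (snd i) ^ L)"
  by (rule evaluates_nat_pow[OF evaluates_base])

lemma evaluates_item_weights:
  "evaluates I input_size (item_weights_prog H L) input_of
     (\<lambda>i. enc_list (map Atom (item_weights H L (snd i))))"
proof -
  define X where "X = (SIGMA i:I. {..<length (snd i)})"
  \<comment> \<open>The order is reversed because \<open>map_loop\<close> traverses the reversed
    list.\<close>
  define d where "d x = rev (snd (fst x)) ! snd x" for x :: "(data \<times> distribution list) \<times> nat"
  have d: "d x \<in> set (snd (fst x))" "fst x \<in> I" if "x \<in> X" for x
    using that nth_mem[of "snd x" "rev (snd (fst x))"] by (auto simp: d_def X_def)
  have "evaluates I input_size (item_weights_prog H L) input_of
     (\<lambda>i. enc_list (map (\<lambda>d. Atom (int (item_weight H L (snd i) d))) (snd i)))"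
    unfolding item_weights_prog_def
  proof (rule evaluates_map_loop[OF evaluates_distributions poly_bounded_length])
    fix u :: "(data \<times> distribution list) \<times> nat \<Rightarrow> data"
    define F where "F x = Node (Node (input_of (fst x))
      (enc_list (drop (snd x) (map enc_distribution (rev (snd (fst x))))))) (u x)" for x
    have el: "evaluates X (\<lambda>x. input_size (fst x)) element F (\<lambda>x. enc_distribution (d x))"
    proof -
      have "evaluates X (\<lambda>x. input_size (fst x)) element F
          (\<lambda>x. map enc_distribution (rev (snd (fst x))) ! snd x)"
        unfolding F_def X_def
        using evaluates_element[where xs = "\<lambda>i. map enc_distribution (rev (snd i))" and I = I
            and u = "\<lambda>x. input_of (fst x)" and w = u]
        by simp
      then show ?thesis by (rule evaluates_cong) (auto simp: d_def X_def)
    qed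
    have size: "poly_bounded X (\<lambda>x. input_size (fst x)) (\<lambda>x. data_size (enc_distribution (d x)))"
    proof (rule poly_bounded_mono[OF poly_bounded_size])
      fix x assume "x \<in> X"
      then have "enc_distribution (d x) \<in> set (map enc_distribution (snd (fst x)))"
        using d by simp
      then show "data_size (enc_distribution (d x)) \<le> input_size (fst x)"
        using data_size_le_enc_list data_size_distributions order_trans by blast
    qed
    have nonneg: "0 \<le> v" if "x \<in> X" "(v, q) \<in> set (d x)" for x v q
      using d[OF that(1)] that(2) unfolding I_def eum_instances_def valid_distribution_def by fastforce
    have N: "evaluates_nat X (\<lambda>x. input_size (fst x)) (outer (grid_points_prog H)) F
        (\<lambda>x. grid_points H (snd (fst x)))"
      unfolding X_def F_def by (rule evaluates_nat_outer[OF evaluates_grid_points])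
    have J: "evaluates_nat X (\<lambda>x. input_size (fst x)) (outer (max_level_prog H)) F
        (\<lambda>x. max_level H (snd (fst x)))"
      unfolding X_def F_def by (rule evaluates_nat_outer[OF evaluates_max_level])
    have B: "evaluates_nat X (\<lambda>x. input_size (fst x)) (outer (base_prog H)) F
        (\<lambda>x. base H (snd (fst x)))"
      unfolding X_def F_def by (rule evaluates_nat_outer[OF evaluates_base])
    have "evaluates_nat X (\<lambda>x. input_size (fst x)) (level_prog (outer (grid_points_prog H))
        (transform_prog k (outer (grid_points_prog H)) (outer (max_level_prog H)) element)
        (outer (max_level_prog H))) F (\<lambda>x. item_level H (snd (fst x)) (d x) k)" for k
      unfolding item_level_def
      by (rule evaluates_level_prog[OF N J evaluates_transform_prog[OF N J el size]])
        (rule nonneg, assumption+)+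
    from evaluates_horner_prog[OF B this]
    have "evaluates_nat X (\<lambda>x. input_size (fst x)) (horner_prog (outer (base_prog H))
        (map (\<lambda>k. level_prog (outer (grid_points_prog H))
          (transform_prog k (outer (grid_points_prog H)) (outer (max_level_prog H)) element)
          (outer (max_level_prog H))) [0..<L])) F
        (\<lambda>x. item_weight H L (snd (fst x)) (d x))"
      unfolding item_weight_def .
    from evaluates_nat_imp[OF this]
    show "evaluates (SIGMA i:I. {..<length (snd i)}) (\<lambda>x. input_size (fst x))
        (horner_prog (outer (base_prog H))
          (map (\<lambda>k. level_prog (outer (grid_points_prog H))
            (transform_prog k (outer (grid_points_prog H)) (outer (max_level_prog H)) element)
            (outer (max_level_prog H))) [0..<L]))
        (\<lambda>x. Node (Node (input_of (fst x))
          (enc_list (drop (snd x) (map enc_distribution (rev (snd (fst x))))))) (u x))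
        (\<lambda>x. Atom (int (item_weight H L (snd (fst x)) (rev (snd (fst x)) ! snd x))))"
      unfolding X_def F_def d_def .
  qed
  then show ?thesis by (simp add: item_weights_def comp_def)
qed

lemma poly_bounded_exact_input:
  "poly_bounded I input_size
     (\<lambda>i. data_size (Node (fst i) (enc_list (map Atom (item_weights H L (snd i))))))"
proof (rule poly_bounded_mono)
  show "poly_bounded I input_size
      (\<lambda>i. 1 + input_size i + (1 + length (snd i) * (2 + base H (snd i) ^ L)))"
    using evaluates_targets[of L] unfolding evaluates_nat_def
    by (intro poly_bounded_add poly_bounded_mult poly_bounded_const poly_bounded_size
        poly_bounded_length) auto
  fix i :: "data \<times> distribution list"
  have bits: "bit_length c \<le> base H (snd i) ^ L" if c: "c \<in> set (item_weights H L (snd i))" for c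
  proof -
    obtain d where "d \<in> set (snd i)" and d: "c = int (item_weight H L (snd i) d)"
      using c unfolding item_weights_def by auto
    then obtain b where "b < length (snd i)" "d = snd i ! b" unfolding in_set_conv_nth by blast
    with d have b: "b < length (snd i)" "c = int (item_weight H L (snd i) (snd i ! b))" by auto
    \<comment> \<open>A single weight is the total weight of a singleton, whether or not that set is
      feasible.\<close>
    have "item_weight H L (snd i) (snd i ! b) < base H (snd i) ^ L"
      using total_weight_less[of "{b}" "snd i" H L] b by (simp add: total_weight_def)
    then show ?thesis using bit_length_int_le[of "item_weight H L (snd i) (snd i ! b)"] b by simp
  qed
  have "data_size (enc_list (map Atom cs)) \<le> 1 + length cs * (2 + m)"
    if "\<And>c. c \<in> set cs \<Longrightarrow> bit_length c \<le> m" for cs m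
    using that
  proof (induction cs)
    case (Cons c cs)
    then have "data_size (enc_list (map Atom cs)) \<le> 1 + length cs * (2 + m)" "bit_length c \<le> m" by auto
    then show ?case by simp
  qed simp
  from this[of "item_weights H L (snd i)", OF bits]
  have "data_size (enc_list (map Atom (item_weights H L (snd i)))) \<le> 1 + length (snd i) * (2 + base H (snd i) ^ L)"
    by (simp only: item_weights_def length_map)
  moreover have "data_size (fst i) \<le> input_size i" by (simp add: eum_input_def)
  ultimately show "data_size (Node (fst i) (enc_list (map Atom (item_weights H L (snd i)))))
      \<le> 1 + input_size i + (1 + length (snd i) * (2 + base H (snd i) ^ L))"
    by simp
qed

context
  fixes p :: prog
  assumes p: "pseudopolynomial_exact A p"
begin

text \<open>The map \<open>h\<close> extracts the instance from a larger index, so that the same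
  statement serves the calls inside the maximization loop and the final call.\<close>

lemma evaluates_exact_item_weights:
  assumes h: "\<And>y. y \<in> Y \<Longrightarrow> h y \<in> I"
    and x: "evaluates Y (\<lambda>y. input_size (h y)) px E (\<lambda>y. fst (h y))"
    and w: "evaluates Y (\<lambda>y. input_size (h y)) pw E
      (\<lambda>y. enc_list (map Atom (item_weights H L (snd (h y)))))"
    and K: "evaluates_nat Y (\<lambda>y. input_size (h y)) pK E K"
  shows "evaluates Y (\<lambda>y. input_size (h y)) (Seq (Fork px (Fork pw pK)) p) E
    (\<lambda>y. exact_answer A p (fst (h y)) (item_weights H L (snd (h y))) (K y))"
proof (rule evaluates_Seq)
  show "evaluates Y (\<lambda>y. input_size (h y)) (Fork px (Fork pw pK)) E
      (\<lambda>y. exact_input (fst (h y)) (item_weights H L (snd (h y))) (int (K y)))"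
    unfolding exact_input_def by (intro evaluates_Fork x w evaluates_nat_imp K)
  show "evaluates Y (\<lambda>y. input_size (h y)) p
      (\<lambda>y. exact_input (fst (h y)) (item_weights H L (snd (h y))) (int (K y)))
      (\<lambda>y. exact_answer A p (fst (h y)) (item_weights H L (snd (h y))) (K y))"
  proof (rule evaluates_exact[OF p])
    show "poly_bounded Y (\<lambda>y. input_size (h y))
        (\<lambda>y. data_size (Node (fst (h y)) (enc_list (map Atom (item_weights H L (snd (h y)))))))"
      using poly_bounded_exact_input h by (rule poly_bounded_reindex)
    show "poly_bounded Y (\<lambda>y. input_size (h y)) K" using K unfolding evaluates_nat_def by blast
    fix y assume "y \<in> Y"
    then have "h y \<in> I" by (rule h)
    then show "fst (h y) \<in> instances A \<and> length (item_weights H L (snd (h y))) = ground_size A (fst (h y))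
        \<and> (\<forall>c\<in>set (item_weights H L (snd (h y))). 0 \<le> c)"
      by (auto simp: I_def eum_instances_def item_weights_def)
  qed
qed

lemma evaluates_Left_input: "evaluates I input_size Left input_of fst"
  unfolding eum_input_def by (rule evaluates_Left)

lemma evaluates_best_target:
  "evaluates_nat I input_size
     (argmax_prog (pow (base_prog H) (Lit (int (length cs)))) (score_prog p H cs)) input_of
     (\<lambda>i. best_target A p H cs (fst i) (snd i))"
  unfolding best_target_def
proof (rule evaluates_argmax_prog[OF evaluates_targets])
  fix u w :: "(data \<times> distribution list) \<times> nat \<Rightarrow> data" and pK and K :: "_ \<Rightarrow> nat"
  define X where "X = (SIGMA i:I. {..<base H (snd i) ^ length cs})"
  define F where "F x = Node (Node (input_of (fst x)) (u x)) (w x)" for x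
  assume "evaluates_nat (SIGMA i:I. {..<base H (snd i) ^ length cs}) (\<lambda>x. input_size (fst x)) pK
    (\<lambda>x. Node (Node (input_of (fst x)) (u x)) (w x)) K"
  then have K: "evaluates_nat X (\<lambda>x. input_size (fst x)) pK F K" unfolding X_def F_def .
  let ?exact = "\<lambda>x. exact_answer A p (fst (fst x)) (item_weights H (length cs) (snd (fst x))) (K x)"
  have "evaluates X (\<lambda>x. input_size (fst x)) (Seq (Fork (outer Left)
      (Fork (outer (item_weights_prog H (length cs))) pK)) p) F ?exact"
  proof (rule evaluates_exact_item_weights[OF _ _ _ K])
    show "evaluates X (\<lambda>x. input_size (fst x)) (outer Left) F (\<lambda>x. fst (fst x))"
      unfolding X_def F_def by (rule evaluates_outer[OF evaluates_Left_input])
    show "evaluates X (\<lambda>x. input_size (fst x)) (outer (item_weights_prog H (length cs))) F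
        (\<lambda>x. enc_list (map Atom (item_weights H (length cs) (snd (fst x)))))"
      unfolding X_def F_def by (rule evaluates_outer[OF evaluates_item_weights])
  qed (auto simp: X_def)
  from evaluates_Seq[OF this evaluates_Is_Node]
  have test: "evaluates X (\<lambda>x. input_size (fst x)) (Seq (Seq (Fork (outer Left)
      (Fork (outer (item_weights_prog H (length cs))) pK)) p) Is_Node) F
      (\<lambda>x. Atom (if \<exists>a b. ?exact x = Node a b then 1 else 0))"
    by (rule evaluates_cong) (auto split: data.split)
  have N: "evaluates_nat X (\<lambda>x. input_size (fst x)) (outer (grid_points_prog H)) F
      (\<lambda>x. grid_points H (snd (fst x)))"
    unfolding X_def F_def by (rule evaluates_nat_outer[OF evaluates_grid_points])
  have B: "evaluates_nat X (\<lambda>x. input_size (fst x)) (outer (base_prog H)) F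
      (\<lambda>x. base H (snd (fst x)))"
    unfolding X_def F_def by (rule evaluates_nat_outer[OF evaluates_base])
  have "evaluates_int X (\<lambda>x. input_size (fst x)) (score_prog p H cs pK) F
      (\<lambda>x. if \<exists>a b. ?exact x = Node a b
        then gain cs (grid_points H (snd (fst x))) (base H (snd (fst x))) (K x)
        else (- 1 - (\<Sum>c\<leftarrow>cs. \<bar>c\<bar>)) * int (grid_points H (snd (fst x))) ^ base H (snd (fst x)))"
    unfolding score_prog_def
    by (intro evaluates_int_Cond test evaluates_gain_prog N B K evaluates_int_times
        evaluates_int_Lit evaluates_int_pow evaluates_int_of_nat[OF N]) (simp add: base_def)
  then have "evaluates_int X (\<lambda>x. input_size (fst x)) (score_prog p H cs pK) F
      (\<lambda>x. score A p H cs (fst (fst x)) (snd (fst x)) (K x))"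
    by (rule evaluates_int_cong) (auto simp: score_def split: data.split)
  then show "evaluates_int (SIGMA i:I. {..<base H (snd i) ^ length cs}) (\<lambda>x. input_size (fst x))
      (score_prog p H cs pK) (\<lambda>x. Node (Node (input_of (fst x)) (u x)) (w x))
      (\<lambda>x. score A p H cs (fst (fst x)) (snd (fst x)) (K x))"
    unfolding X_def F_def .
qed

lemma evaluates_eum_prog:
  "evaluates I input_size (eum_prog p H cs) input_of
     (\<lambda>i. case selected A p H cs (fst i) (snd i) of Atom a \<Rightarrow> Atom a | Node _ v \<Rightarrow> v)"
proof -
  let ?s = "\<lambda>i. selected A p H cs (fst i) (snd i)"
  have 1: "evaluates I input_size (Seq (Fork Left (Fork (item_weights_prog H (length cs))
      (argmax_prog (pow (base_prog H) (Lit (int (length cs)))) (score_prog p H cs)))) p) input_of ?s"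
    unfolding selected_def
    using evaluates_exact_item_weights[of I "\<lambda>i. i", OF _ evaluates_Left_input evaluates_item_weights
        evaluates_best_target] by simp
  have "evaluates I input_size Is_Node ?s (\<lambda>i. Atom (if \<exists>a b. ?s i = Node a b then 1 else 0))"
    using evaluates_Is_Node by (rule evaluates_cong) (auto split: data.split)
  moreover have "evaluates {i \<in> I. \<exists>a b. ?s i = Node a b} input_size Right ?s
      (\<lambda>i. case ?s i of Atom a \<Rightarrow> Atom a | Node _ v \<Rightarrow> v)"
  proof -
    \<comment> \<open>The rule for \<open>Right\<close> needs a result that is visibly a node; the
      two case expressions supply its children and agree with them on this subfamily.\<close>
    have "evaluates {i \<in> I. \<exists>a b. ?s i = Node a b} input_size Right
        (\<lambda>i. Node (case ?s i of Atom a \<Rightarrow> Atom a | Node u _ \<Rightarrow> u) (case ?s i of Atom a \<Rightarrow> Atom a | Node _ v \<Rightarrow> v))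
        (\<lambda>i. case ?s i of Atom a \<Rightarrow> Atom a | Node _ v \<Rightarrow> v)"
      by (rule evaluates_Right)
    then show ?thesis by (rule evaluates_cong) auto
  qed
  ultimately have "evaluates I input_size (Cond Is_Node Right Skip) ?s
      (\<lambda>i. if \<exists>a b. ?s i = Node a b then case ?s i of Atom a \<Rightarrow> Atom a | Node _ v \<Rightarrow> v else ?s i)"
    by (rule evaluates_Cond) (rule evaluates_Skip)
  then have "evaluates I input_size (Cond Is_Node Right Skip) ?s
      (\<lambda>i. case ?s i of Atom a \<Rightarrow> Atom a | Node _ v \<Rightarrow> v)"
    by (rule evaluates_cong) (auto split: data.split)
  with 1 show ?thesis unfolding eum_prog_def by (rule evaluates_Seq)
qed

end

end

theorem theorem1:
  fixes A :: problem and \<mu> :: "real \<Rightarrow> real" and \<alpha> \<epsilon> :: real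
  assumes "combinatorial_problem A"
    and "\<exists>p. pseudopolynomial_exact A p"
    and "\<forall>x. 0 \<le> \<mu> x"
    and "(\<mu> \<longlongrightarrow> 0) at_top"
    and "0 < \<alpha>"
    and "\<alpha>-lipschitz_on {0..} \<mu>"
    and "0 < \<epsilon>"
  shows "\<exists>p. polynomial_time_eum A \<mu> \<epsilon> p"
proof -
  obtain p where p: "pseudopolynomial_exact A p" using assms(2) by blast
  have cont: "continuous_on {0..} \<mu>" using assms(6) by (rule lipschitz_on_continuous_on)
  have "0 < \<epsilon> / 4" using assms(7) by simp
  show ?thesis
  proof (rule exponential_approximation[OF cont assms(4) \<open>0 < \<epsilon> / 4\<close>])
    fix cs :: "int list" and D :: nat
    assume D: "0 < D" and approx: "\<And>x. 0 \<le> x \<Longrightarrow>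
      \<bar>\<mu> x - (\<Sum>k<length cs. of_int (cs ! k) / D * exp (- x) ^ k)\<bar> \<le> \<epsilon> / 4"
    define \<Lambda> where "\<Lambda> = (\<Sum>k<length cs. \<bar>of_int (cs ! k) / D\<bar> * (k + 1))"
    have "0 \<le> \<Lambda>" unfolding \<Lambda>_def by (intro sum_nonneg) auto
    \<comment> \<open>A strict bound also gives \<open>0 < H\<close> when
      \<open>\<Lambda> = 0\<close>. Neither \<open>H\<close> nor \<open>cs\<close> depends on the
      input, so one program serves all instances.\<close>
    obtain H :: nat where H: "4 * \<Lambda> / \<epsilon> < H" using reals_Archimedean2 by blast
    moreover have "0 \<le> 4 * \<Lambda> / \<epsilon>" using \<open>0 \<le> \<Lambda>\<close> \<open>0 < \<epsilon>\<close> by simp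
    ultimately have "0 < real H" by linarith
    then have "0 < H" "\<Lambda> / H \<le> \<epsilon> / 4" using H \<open>0 < \<epsilon>\<close> by (auto simp: field_simps)
    obtain t where "poly_bounded (eum_instances A) (\<lambda>i. data_size (eum_input (fst i) (snd i))) t"
      and run: "\<And>i. i \<in> eum_instances A \<Longrightarrow> run (eum_prog p H cs) (eum_input (fst i) (snd i))
        (case selected A p H cs (fst i) (snd i) of Atom a \<Rightarrow> Atom a | Node _ v \<Rightarrow> v) (t i)"
      using evaluates_eum_prog[OF p, of H cs] unfolding evaluates_def by blast
    then obtain P :: "nat poly" where
      P: "\<And>i. i \<in> eum_instances A \<Longrightarrow> t i \<le> poly P (data_size (eum_input (fst i) (snd i)))"
      unfolding poly_bounded_def by blast
    have "outputs_within (eum_prog p H cs) (eum_input x ds) (poly P (data_size (eum_input x ds)))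
        (eum_answers A \<mu> \<epsilon> x ds)"
      if "x \<in> instances A" "length ds = ground_size A x" "\<forall>d\<in>set ds. valid_distribution d" for x ds
    proof -
      have "(x, ds) \<in> eum_instances A" using that by (simp add: eum_instances_def)
      moreover have "(case selected A p H cs x ds of Atom a \<Rightarrow> Atom a | Node _ v \<Rightarrow> v)
          \<in> eum_answers A \<mu> \<epsilon> x ds"
        using assms(1) p \<open>0 < H\<close> D approx \<open>\<Lambda> / H \<le> \<epsilon> / 4\<close>[unfolded \<Lambda>_def] that
        by (rule selected_correct)
      ultimately show ?thesis
        using run[of "(x, ds)"] P[of "(x, ds)"] unfolding outputs_within_def fst_conv snd_conv by blast
    qed
    then have "polynomial_time_eum A \<mu> \<epsilon> (eum_prog p H cs)"
      unfolding polynomial_time_eum_def by blast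
    then show "\<exists>p. polynomial_time_eum A \<mu> \<epsilon> p" by blast
  qed
qed

end
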